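(* Let $G$ be a group, $\Delta=\bigoplus_{\sigma\in G}\Delta_\sigma$ a $G$-graded division ring, $n$ a positive integer, $g_1,\ldots,g_n\in G$, and let $A=M_n(\Delta)(g_1,\ldots,g_n)$. (i) The number of isomorphism types of graded simple left $A$-modules is $[G:\mathrm{supp}(\Delta)]$. (ii) There is a bijective correspondence between the set of isomorphism types of graded simple left $A$-modules that embed into $A$ (as graded modules) and the set of the right $\mathrm{supp}(\Delta)$-cosets $\mathrm{supp}(\Delta)g$ of $G$ containing at least one $g_i$. Moreover, the multiplicity in $A$ of one of these graded simple modules is the number of the $g_i$'s (counted over the indices $1\leq i\leq n$) lying in the corresponding coset. (iii) $A$ is gr-uniform simple, i.e., all the simple graded left submodules of $A$ are isomorphic, if and only if all $g_1,\ldots,g_n$ lie in the same right $\mathrm{supp}(\Delta)$-coset of $G$.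
   Context: A $G$-graded ring is a ring with identity $R=\bigoplus_{g\in G}R_g$ with $R_gR_h\subset R_{gh}$. A $G$-graded division ring is a (nonzero) $G$-graded ring all of whose nonzero homogeneous elements are invertible; $\mathrm{supp}(\Delta)=\{\sigma\in G:\Delta_\sigma\neq 0\}$, a subgroup of $G$. The graded ring $A=M_n(\Delta)(g_1,\ldots,g_n)$ is $M_n(\Delta)$ as a ring, with $A_\sigma$ the set of matrices whose $(i,j)$ entry lies in $\Delta_{g_i\sigma g_j^{-1}}$ for all $i,j$. Graded left modules are $M=\bigoplus_gM_g$ with $A_gM_h\subset M_{gh}$; isomorphisms and embeddings are degree-preserving $A$-linear maps. A nonzero graded module is graded simple if it has no proper nonzero graded submodules. $A$ is a finite direct sum of graded simple left modules, and the multiplicity of a graded simple module in $A$ is the number of summands isomorphic to it. *)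

theory Defs
  imports
    "HOL-Algebra.AbelCoset"
    "HOL-Algebra.Module"
    "HOL-Library.Equipollence"
    "Jordan_Normal_Form.VS_Connect"
begin

text \<open>The locale \<^locale>\<open>module\<close> of HOL-Algebra requires a commutative ring of scalars, so
  (unital) left modules over an arbitrary ring are introduced here, on the same records.\<close>

locale left_module = R?: ring R + M?: abelian_group M
  for R :: "('a, 'y) ring_scheme" (structure) and M :: "('a, 'b, 'm) module_scheme" (structure) +
  assumes smult_closed: "\<lbrakk> a \<in> carrier R; x \<in> carrier M \<rbrakk> \<Longrightarrow> a \<odot>\<^bsub>M\<^esub> x \<in> carrier M"
    and smult_l_distr: "\<lbrakk> a \<in> carrier R; b \<in> carrier R; x \<in> carrier M \<rbrakk> \<Longrightarrow>
      (a \<oplus>\<^bsub>R\<^esub> b) \<odot>\<^bsub>M\<^esub> x = a \<odot>\<^bsub>M\<^esub> x \<oplus>\<^bsub>M\<^esub> b \<odot>\<^bsub>M\<^esub> x"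
    and smult_r_distr: "\<lbrakk> a \<in> carrier R; x \<in> carrier M; y \<in> carrier M \<rbrakk> \<Longrightarrow>
      a \<odot>\<^bsub>M\<^esub> (x \<oplus>\<^bsub>M\<^esub> y) = a \<odot>\<^bsub>M\<^esub> x \<oplus>\<^bsub>M\<^esub> a \<odot>\<^bsub>M\<^esub> y"
    and smult_assoc: "\<lbrakk> a \<in> carrier R; b \<in> carrier R; x \<in> carrier M \<rbrakk> \<Longrightarrow>
      (a \<otimes>\<^bsub>R\<^esub> b) \<odot>\<^bsub>M\<^esub> x = a \<odot>\<^bsub>M\<^esub> (b \<odot>\<^bsub>M\<^esub> x)"
    and smult_one: "x \<in> carrier M \<Longrightarrow> \<one>\<^bsub>R\<^esub> \<odot>\<^bsub>M\<^esub> x = x"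


section \<open>Graded rings\<close>

text \<open>\<open>is_grading G M P\<close> says that the additive group of \<open>M\<close> is the internal direct sum of the
  subgroups \<open>P \<sigma>\<close>, where \<open>\<sigma>\<close> ranges over the carrier of \<open>G\<close>. Values of \<open>P\<close> outside the carrier
  of \<open>G\<close> are irrelevant.\<close>

definition is_grading ::
  "('g, 'x) monoid_scheme \<Rightarrow> ('b, 'y) ring_scheme \<Rightarrow> ('g \<Rightarrow> 'b set) \<Rightarrow> bool" where
  "is_grading G M P \<longleftrightarrow>
     (\<forall>\<sigma>\<in>carrier G. additive_subgroup (P \<sigma>) M) \<and>
     (\<forall>x\<in>carrier M. \<exists>!c.
        (\<forall>\<sigma>\<in>carrier G. c \<sigma> \<in> P \<sigma>) \<and> (\<forall>\<sigma>. \<sigma> \<notin> carrier G \<longrightarrow> c \<sigma> = \<zero>\<^bsub>M\<^esub>) \<and>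
        finite {\<sigma>. c \<sigma> \<noteq> \<zero>\<^bsub>M\<^esub>} \<and> x = finsum M c {\<sigma>. c \<sigma> \<noteq> \<zero>\<^bsub>M\<^esub>})"

definition graded_ring ::
  "('g, 'x) monoid_scheme \<Rightarrow> ('a, 'y) ring_scheme \<Rightarrow> ('g \<Rightarrow> 'a set) \<Rightarrow> bool" where
  "graded_ring G R P \<longleftrightarrow>
     ring R \<and> is_grading G R P \<and>
     (\<forall>\<sigma>\<in>carrier G. \<forall>\<tau>\<in>carrier G. \<forall>a\<in>P \<sigma>. \<forall>b\<in>P \<tau>. a \<otimes>\<^bsub>R\<^esub> b \<in> P (\<sigma> \<otimes>\<^bsub>G\<^esub> \<tau>))"

definition graded_division_ring ::
  "('g, 'x) monoid_scheme \<Rightarrow> ('a, 'y) ring_scheme \<Rightarrow> ('g \<Rightarrow> 'a set) \<Rightarrow> bool" where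
  "graded_division_ring G R P \<longleftrightarrow>
     graded_ring G R P \<and> \<one>\<^bsub>R\<^esub> \<noteq> \<zero>\<^bsub>R\<^esub> \<and>
     (\<forall>\<sigma>\<in>carrier G. \<forall>a\<in>P \<sigma>. a \<noteq> \<zero>\<^bsub>R\<^esub> \<longrightarrow> a \<in> Units R)"

definition gr_supp ::
  "('g, 'x) monoid_scheme \<Rightarrow> ('a, 'y) ring_scheme \<Rightarrow> ('g \<Rightarrow> 'a set) \<Rightarrow> 'g set" where
  "gr_supp G R P = {\<sigma> \<in> carrier G. P \<sigma> \<noteq> {\<zero>\<^bsub>R\<^esub>}}"

text \<open>The grading of \<open>M\<^sub>n(\<Delta>)(g\<^sub>1, \<dots>, g\<^sub>n)\<close>. Indices run over \<open>{0..<n}\<close> instead of \<open>{1..n}\<close>.\<close>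

definition matrix_grading ::
  "('g, 'x) monoid_scheme \<Rightarrow> ('g \<Rightarrow> 'd set) \<Rightarrow> nat \<Rightarrow> (nat \<Rightarrow> 'g) \<Rightarrow> 'g \<Rightarrow> 'd mat set" where
  "matrix_grading G \<Delta> n g \<sigma> =
     {a \<in> carrier_mat n n.
        \<forall>i<n. \<forall>j<n. a $$ (i, j) \<in> \<Delta> (g i \<otimes>\<^bsub>G\<^esub> \<sigma> \<otimes>\<^bsub>G\<^esub> inv\<^bsub>G\<^esub> (g j))}"


section \<open>Graded left modules\<close>

record ('a, 'b, 'g) gr_module = "('a, 'b) module" +
  gr_part :: "'g \<Rightarrow> 'b set"

locale graded_left_module = left_module R M
  for G :: "('g, 'x) monoid_scheme" and R :: "('a, 'y) ring_scheme" and P :: "'g \<Rightarrow> 'a set"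
    and M :: "('a, 'b, 'g) gr_module" +
  assumes module_grading: "is_grading G M (gr_part M)"
    and smult_graded: "\<lbrakk> \<sigma> \<in> carrier G; \<tau> \<in> carrier G; a \<in> P \<sigma>; x \<in> gr_part M \<tau> \<rbrakk> \<Longrightarrow>
      a \<odot>\<^bsub>M\<^esub> x \<in> gr_part M (\<sigma> \<otimes>\<^bsub>G\<^esub> \<tau>)"

text \<open>The ring as a graded left module over itself; the fields \<open>mult\<close> and \<open>one\<close>, which every
  module record inherits, play no role.\<close>

definition regular_gr_module ::
  "('a, 'y) ring_scheme \<Rightarrow> ('g \<Rightarrow> 'a set) \<Rightarrow> ('a, 'a, 'g) gr_module" where
  "regular_gr_module R P =
     \<lparr>carrier = carrier R, mult = mult R, one = one R, zero = zero R, add = add R,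
      smult = mult R, gr_part = P\<rparr>"

definition gr_hom ::
  "('g, 'x) monoid_scheme \<Rightarrow> ('a, 'y) ring_scheme \<Rightarrow> ('a, 'b, 'g) gr_module \<Rightarrow>
    ('a, 'c, 'g) gr_module \<Rightarrow> ('b \<Rightarrow> 'c) set" where
  "gr_hom G R M N =
     {f \<in> carrier M \<rightarrow> carrier N.
        (\<forall>x\<in>carrier M. \<forall>y\<in>carrier M. f (x \<oplus>\<^bsub>M\<^esub> y) = f x \<oplus>\<^bsub>N\<^esub> f y) \<and>
        (\<forall>a\<in>carrier R. \<forall>x\<in>carrier M. f (a \<odot>\<^bsub>M\<^esub> x) = a \<odot>\<^bsub>N\<^esub> f x) \<and>
        (\<forall>\<sigma>\<in>carrier G. f ` gr_part M \<sigma> \<subseteq> gr_part N \<sigma>)}"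

definition gr_iso ::
  "('g, 'x) monoid_scheme \<Rightarrow> ('a, 'y) ring_scheme \<Rightarrow> ('a, 'b, 'g) gr_module \<Rightarrow>
    ('a, 'c, 'g) gr_module \<Rightarrow> bool" where
  "gr_iso G R M N \<longleftrightarrow> (\<exists>f\<in>gr_hom G R M N. bij_betw f (carrier M) (carrier N))"

definition gr_embeds ::
  "('g, 'x) monoid_scheme \<Rightarrow> ('a, 'y) ring_scheme \<Rightarrow> ('a, 'b, 'g) gr_module \<Rightarrow>
    ('a, 'c, 'g) gr_module \<Rightarrow> bool" where
  "gr_embeds G R M N \<longleftrightarrow> (\<exists>f\<in>gr_hom G R M N. inj_on f (carrier M))"

definition gr_restrict :: "('a, 'b, 'g) gr_module \<Rightarrow> 'b set \<Rightarrow> ('a, 'b, 'g) gr_module" where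
  "gr_restrict M N = M\<lparr>carrier := N, gr_part := (\<lambda>\<sigma>. N \<inter> gr_part M \<sigma>)\<rparr>"

text \<open>\<open>Module.submodule\<close> (HOL-Algebra) is meaningful over any ring, unlike the locale of the same
  base name in Jordan_Normal_Form, which assumes commutative scalars.\<close>

definition gr_submodule ::
  "('g, 'x) monoid_scheme \<Rightarrow> ('a, 'y) ring_scheme \<Rightarrow> ('a, 'b, 'g) gr_module \<Rightarrow> 'b set \<Rightarrow> bool" where
  "gr_submodule G R M N \<longleftrightarrow>
     Module.submodule N R M \<and> is_grading G (gr_restrict M N) (gr_part (gr_restrict M N))"

definition gr_simple ::
  "('g, 'x) monoid_scheme \<Rightarrow> ('a, 'y) ring_scheme \<Rightarrow> ('g \<Rightarrow> 'a set) \<Rightarrow>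
    ('a, 'b, 'g) gr_module \<Rightarrow> bool" where
  "gr_simple G R P M \<longleftrightarrow>
     graded_left_module G R P M \<and> carrier M \<noteq> {\<zero>\<^bsub>M\<^esub>} \<and>
     (\<forall>N. gr_submodule G R M N \<longrightarrow> N = {\<zero>\<^bsub>M\<^esub>} \<or> N = carrier M)"

text \<open>Isomorphism types of graded simple modules whose elements are taken from a type \<open>'b\<close>.
  All such modules form a proper class; \<open>'b\<close> plays the role of the universe.\<close>

definition gr_simple_types ::
  "('g, 'x) monoid_scheme \<Rightarrow> ('a, 'y) ring_scheme \<Rightarrow> ('g \<Rightarrow> 'a set) \<Rightarrow>
    ('a, 'b, 'g) gr_module set set" where
  "gr_simple_types G R P =
     {M. gr_simple G R P M} //
     {(M, N). gr_simple G R P M \<and> gr_simple G R P N \<and> gr_iso G R M N}"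

text \<open>\<open>M\<close> is the internal direct sum of the graded simple submodules \<open>S 0, \<dots>, S (m - 1)\<close>.\<close>

definition gr_simple_decomposition ::
  "('g, 'x) monoid_scheme \<Rightarrow> ('a, 'y) ring_scheme \<Rightarrow> ('g \<Rightarrow> 'a set) \<Rightarrow>
    ('a, 'b, 'g) gr_module \<Rightarrow> nat \<Rightarrow> (nat \<Rightarrow> 'b set) \<Rightarrow> bool" where
  "gr_simple_decomposition G R P M m S \<longleftrightarrow>
     (\<forall>k<m. gr_submodule G R M (S k) \<and> gr_simple G R P (gr_restrict M (S k))) \<and>
     (\<forall>x\<in>carrier M. \<exists>!y. y \<in> (\<Pi>\<^sub>E k\<in>{..<m}. S k) \<and> x = finsum M y {..<m})"

text \<open>\<open>has_gr_multiplicity G R P M N r\<close>: the multiplicity of \<open>N\<close> in \<open>M\<close> is \<open>r\<close>. A decomposition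
  of \<open>M\<close> into graded simple modules is required to exist, and every such decomposition must have
  exactly \<open>r\<close> summands isomorphic to \<open>N\<close>.\<close>

definition has_gr_multiplicity ::
  "('g, 'x) monoid_scheme \<Rightarrow> ('a, 'y) ring_scheme \<Rightarrow> ('g \<Rightarrow> 'a set) \<Rightarrow>
    ('a, 'b, 'g) gr_module \<Rightarrow> ('a, 'c, 'g) gr_module \<Rightarrow> nat \<Rightarrow> bool" where
  "has_gr_multiplicity G R P M N r \<longleftrightarrow>
     (\<exists>m S. gr_simple_decomposition G R P M m S) \<and>
     (\<forall>m S. gr_simple_decomposition G R P M m S \<longrightarrow>
        card {k. k < m \<and> gr_iso G R (gr_restrict M (S k)) N} = r)"

definition gr_uniform_simple ::
  "('g, 'x) monoid_scheme \<Rightarrow> ('a, 'y) ring_scheme \<Rightarrow> ('g \<Rightarrow> 'a set) \<Rightarrow> bool" where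
  "gr_uniform_simple G R P \<longleftrightarrow>
     (let A = regular_gr_module R P in
       \<forall>N N'. gr_submodule G R A N \<and> gr_simple G R P (gr_restrict A N) \<and>
              gr_submodule G R A N' \<and> gr_simple G R P (gr_restrict A N') \<longrightarrow>
              gr_iso G R (gr_restrict A N) (gr_restrict A N'))"

end

(* For h in G let V h be the column module Delta^n with (V h)_rho consisting of the columns whose k-th
   entry lies in Delta_(g_k rho h^-1). A graded homomorphism out of V h is determined by the image of the
   first unit column, which may be any element of degree g_0^-1 h fixed by the matrix unit e_00. Since
   nonzero homogeneous entries are invertible, nonzero homomorphisms out of V h are injective with graded
   simple image; hence every graded simple module is isomorphic to some V h, and V h is isomorphic to V k
   iff h k^-1 lies in supp(Delta). The j-th column of A is V (g_j), which gives one decomposition of A.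
   For the multiplicities, e_00 A_(g_0^-1 h) is a left vector space over the division ring Delta_1 whose
   dimension is the number of j with g_j in supp(Delta) h, and every decomposition of A yields a basis
   with one vector for each summand isomorphic to V h. *)

theory Submission
  imports Defs
begin

section \<open>Graded abelian groups\<close>

text \<open>The degree g_0^-1 h is the one in which the unit column of \<open>V h\<close> is
  homogeneous: its entry 1 has degree 1, which forces g_0 rho h^-1 = 1. Fixing the corner e_00
  reduces a homomorphism from \<open>V h\<close> into a module of matrices to a single row, whose
  entry in column l lies in Delta_(h k_l^-1), where k_l is the label of that column. For the target
  \<open>V k\<close> this gives the coset criterion. For A it gives the dimension, because Delta_(h
  g_l^-1) is zero or one-dimensional over Delta_1, according to whether g_l lies in supp(Delta) h. A
  multiplicity is a claim about every decomposition of A; the dimension count supplies this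
  uniqueness in place of a Krull-Schmidt theorem. Since Delta_1 is only a subset of Delta and the
  entries of the row usually lie outside it, the linear algebra is done in coordinates, with scalars
  from a subset and arbitrary ring elements as coordinates.\<close>

definition gr_comp ::
  "('g, 'x) monoid_scheme \<Rightarrow> ('b, 'y) ring_scheme \<Rightarrow> ('g \<Rightarrow> 'b set) \<Rightarrow> 'b \<Rightarrow> 'g \<Rightarrow> 'b" where
  "gr_comp G M P x = (THE c.
     (\<forall>\<sigma>\<in>carrier G. c \<sigma> \<in> P \<sigma>) \<and> (\<forall>\<sigma>. \<sigma> \<notin> carrier G \<longrightarrow> c \<sigma> = \<zero>\<^bsub>M\<^esub>) \<and>
     finite {\<sigma>. c \<sigma> \<noteq> \<zero>\<^bsub>M\<^esub>} \<and> x = finsum M c {\<sigma>. c \<sigma> \<noteq> \<zero>\<^bsub>M\<^esub>})"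

lemma (in abelian_group) additive_cancel_zero:
  assumes "x \<in> carrier G" "x \<oplus> x = x"
  shows "x = \<zero>"
  using assms add.l_cancel_one by blast

text \<open>Gradings are built from projections. An element and the sum of its projections differ by
  something that all projections kill, so \<open>sep\<close> gives existence; applying the
  projections to any decomposition reads off its terms, which gives uniqueness.\<close>

lemma is_gradingI:
  fixes M (structure)
  assumes "abelian_group M"
    and sub: "\<And>\<sigma>. \<sigma> \<in> carrier G \<Longrightarrow> additive_subgroup (P \<sigma>) M"
    and closed: "\<And>x \<sigma>. x \<in> carrier M \<Longrightarrow> \<sigma> \<in> carrier G \<Longrightarrow> \<pi> x \<sigma> \<in> P \<sigma>"
    and add: "\<And>x y \<sigma>. x \<in> carrier M \<Longrightarrow> y \<in> carrier M \<Longrightarrow> \<sigma> \<in> carrier G \<Longrightarrow>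
      \<pi> (x \<oplus> y) \<sigma> = \<pi> x \<sigma> \<oplus> \<pi> y \<sigma>"
    and homog: "\<And>x \<sigma> \<rho>. \<sigma> \<in> carrier G \<Longrightarrow> \<rho> \<in> carrier G \<Longrightarrow> x \<in> P \<sigma> \<Longrightarrow>
      \<pi> x \<rho> = (if \<rho> = \<sigma> then x else \<zero>)"
    and fin: "\<And>x. x \<in> carrier M \<Longrightarrow> finite {\<sigma>\<in>carrier G. \<pi> x \<sigma> \<noteq> \<zero>}"
    and sep: "\<And>x. x \<in> carrier M \<Longrightarrow> (\<And>\<sigma>. \<sigma> \<in> carrier G \<Longrightarrow> \<pi> x \<sigma> = \<zero>) \<Longrightarrow> x = \<zero>"
  shows "is_grading G M P"
proof -
  interpret abelian_group M by fact
  have sub_carrier: "x \<in> carrier M" if "\<sigma> \<in> carrier G" "x \<in> P \<sigma>" for x \<sigma>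
    using additive_subgroup.a_Hcarr[OF sub] that by blast
  have zero: "\<pi> \<zero> \<sigma> = \<zero>" if "\<sigma> \<in> carrier G" for \<sigma>
    using homog[OF that that additive_subgroup.zero_closed[OF sub[OF that]]] by simp
  have comp: "\<pi> (finsum M c I) \<rho> = (if \<rho> \<in> I then c \<rho> else \<zero>)"
    if "finite I" "I \<subseteq> carrier G" "\<And>\<sigma>. \<sigma> \<in> carrier G \<Longrightarrow> c \<sigma> \<in> P \<sigma>" "\<rho> \<in> carrier G" for c I \<rho>
    using that(1,2)
  proof (induction I)
    case empty
    then show ?case using zero that(4) by simp
  next
    case (insert \<sigma> I)
    have c: "c \<in> I \<rightarrow> carrier M" "c \<sigma> \<in> carrier M" "c \<rho> \<in> carrier M"
      using insert.prems that(3,4) sub_carrier by auto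
    have "\<pi> (finsum M c (insert \<sigma> I)) \<rho> = \<pi> (c \<sigma>) \<rho> \<oplus> \<pi> (finsum M c I) \<rho>"
      using insert.hyps c that(4) by (simp add: add)
    also have "\<dots> = (if \<rho> \<in> insert \<sigma> I then c \<rho> else \<zero>)"
      using insert c homog[of \<sigma> \<rho> "c \<sigma>"] that(3,4) by auto
    finally show ?case .
  qed
  show ?thesis
    unfolding is_grading_def
  proof (intro conjI ballI)
    fix x assume x: "x \<in> carrier M"
    \<comment> \<open>Unique existence in \<open>is_grading\<close> ranges over families on the
      whole type, so the projections are extended by zero outside the group.\<close>
    define c where "c = (\<lambda>\<sigma>. if \<sigma> \<in> carrier G then \<pi> x \<sigma> else \<zero>)"
    let ?I = "{\<sigma>. c \<sigma> \<noteq> \<zero>}"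
    have I: "?I = {\<sigma>\<in>carrier G. \<pi> x \<sigma> \<noteq> \<zero>}" by (auto simp: c_def)
    have finI: "finite ?I" using fin[OF x] I by simp
    have cP: "\<And>\<sigma>. \<sigma> \<in> carrier G \<Longrightarrow> c \<sigma> \<in> P \<sigma>" using closed x by (simp add: c_def)
    define y where "y = finsum M c ?I"
    have ycar: "y \<in> carrier M"
      unfolding y_def using cP sub_carrier I by (intro finsum_closed) auto
    have piy: "\<pi> y \<sigma> = \<pi> x \<sigma>" if "\<sigma> \<in> carrier G" for \<sigma>
      using comp[OF finI _ cP that] that I unfolding y_def by (auto simp: c_def)
    have "x \<oplus> \<ominus> y = \<zero>"
    proof (rule sep)
      show "x \<oplus> \<ominus> y \<in> carrier M" using x ycar by simp
      fix \<sigma> assume \<sigma>: "\<sigma> \<in> carrier G"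
      have "\<pi> (x \<oplus> \<ominus> y) \<sigma> = \<pi> x \<sigma> \<oplus> \<pi> (\<ominus> y) \<sigma>" using x ycar \<sigma> by (simp add: add)
      also have "\<dots> = \<pi> (y \<oplus> \<ominus> y) \<sigma>" using piy[OF \<sigma>] ycar \<sigma> by (simp add: add)
      finally show "\<pi> (x \<oplus> \<ominus> y) \<sigma> = \<zero>" using zero[OF \<sigma>] ycar by (simp add: r_neg)
    qed
    then have xy: "x = y" using x ycar by (metis add.inv_equality add.inv_inv a_inv_closed)
    show "\<exists>!c. (\<forall>\<sigma>\<in>carrier G. c \<sigma> \<in> P \<sigma>) \<and> (\<forall>\<sigma>. \<sigma> \<notin> carrier G \<longrightarrow> c \<sigma> = \<zero>) \<and>
        finite {\<sigma>. c \<sigma> \<noteq> \<zero>} \<and> x = finsum M c {\<sigma>. c \<sigma> \<noteq> \<zero>}"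
    proof (rule ex1I[of _ c])
      show "(\<forall>\<sigma>\<in>carrier G. c \<sigma> \<in> P \<sigma>) \<and> (\<forall>\<sigma>. \<sigma> \<notin> carrier G \<longrightarrow> c \<sigma> = \<zero>) \<and>
        finite {\<sigma>. c \<sigma> \<noteq> \<zero>} \<and> x = finsum M c {\<sigma>. c \<sigma> \<noteq> \<zero>}"
      proof (intro conjI)
        show "x = finsum M c {\<sigma>. c \<sigma> \<noteq> \<zero>}" using xy unfolding y_def .
      qed (use cP finI in \<open>auto simp: c_def\<close>)
      fix c' assume c': "(\<forall>\<sigma>\<in>carrier G. c' \<sigma> \<in> P \<sigma>) \<and> (\<forall>\<sigma>. \<sigma> \<notin> carrier G \<longrightarrow> c' \<sigma> = \<zero>) \<and>
        finite {\<sigma>. c' \<sigma> \<noteq> \<zero>} \<and> x = finsum M c' {\<sigma>. c' \<sigma> \<noteq> \<zero>}"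
      then have "{\<sigma>. c' \<sigma> \<noteq> \<zero>} \<subseteq> carrier G" by blast
      then have "\<pi> x \<rho> = c' \<rho>" if "\<rho> \<in> carrier G" for \<rho>
        using comp[of "{\<sigma>. c' \<sigma> \<noteq> \<zero>}" c' \<rho>] c' that by auto
      then show "c' = c" using c' by (auto simp: c_def)
    qed
  qed (rule sub)
qed

locale graded_group = abelian_group M for M (structure) +
  fixes G :: "('g, 'x) monoid_scheme" and P
  assumes grading: "is_grading G M P"
begin

abbreviation comp where "comp \<equiv> gr_comp G M P"

lemma part_subgroup: "\<sigma> \<in> carrier G \<Longrightarrow> additive_subgroup (P \<sigma>) M"
  using grading by (simp add: is_grading_def)

lemma part_carrier: "\<lbrakk>\<sigma> \<in> carrier G; x \<in> P \<sigma>\<rbrakk> \<Longrightarrow> x \<in> carrier M"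
  using additive_subgroup.a_Hcarr[OF part_subgroup] by blast

lemma part_zero: "\<sigma> \<in> carrier G \<Longrightarrow> \<zero> \<in> P \<sigma>"
  using additive_subgroup.zero_closed[OF part_subgroup] by blast

lemma part_add: "\<lbrakk>\<sigma> \<in> carrier G; x \<in> P \<sigma>; y \<in> P \<sigma>\<rbrakk> \<Longrightarrow> x \<oplus> y \<in> P \<sigma>"
  using additive_subgroup.a_closed[OF part_subgroup] by blast

lemma part_uminus: "\<lbrakk>\<sigma> \<in> carrier G; x \<in> P \<sigma>\<rbrakk> \<Longrightarrow> \<ominus> x \<in> P \<sigma>"
  using part_subgroup[THEN additive_subgroup.a_subgroup, THEN subgroup.m_inv_closed]
  by (simp add: a_inv_def)

lemma comp_spec:
  assumes "x \<in> carrier M"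
  shows "\<And>\<sigma>. \<sigma> \<in> carrier G \<Longrightarrow> comp x \<sigma> \<in> P \<sigma>"
    and "\<And>\<sigma>. \<sigma> \<notin> carrier G \<Longrightarrow> comp x \<sigma> = \<zero>"
    and "finite {\<sigma>. comp x \<sigma> \<noteq> \<zero>}"
    and "finsum M (comp x) {\<sigma>. comp x \<sigma> \<noteq> \<zero>} = x"
proof -
  have "\<exists>!c. (\<forall>\<sigma>\<in>carrier G. c \<sigma> \<in> P \<sigma>) \<and> (\<forall>\<sigma>. \<sigma> \<notin> carrier G \<longrightarrow> c \<sigma> = \<zero>) \<and>
     finite {\<sigma>. c \<sigma> \<noteq> \<zero>} \<and> x = finsum M c {\<sigma>. c \<sigma> \<noteq> \<zero>}"
    using grading assms unfolding is_grading_def by blast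
  from theI'[OF this] show
    "\<And>\<sigma>. \<sigma> \<in> carrier G \<Longrightarrow> comp x \<sigma> \<in> P \<sigma>"
    "\<And>\<sigma>. \<sigma> \<notin> carrier G \<Longrightarrow> comp x \<sigma> = \<zero>"
    "finite {\<sigma>. comp x \<sigma> \<noteq> \<zero>}"
    "finsum M (comp x) {\<sigma>. comp x \<sigma> \<noteq> \<zero>} = x"
    unfolding gr_comp_def[symmetric] by simp_all
qed

lemma comp_carrier: "x \<in> carrier M \<Longrightarrow> comp x \<sigma> \<in> carrier M"
  by (cases "\<sigma> \<in> carrier G") (auto simp: comp_spec intro: part_carrier[of \<sigma>])

lemma finsum_support:
  assumes "finite I" "{\<sigma>. c \<sigma> \<noteq> \<zero>} \<subseteq> I" "\<And>\<sigma>. c \<sigma> \<in> carrier M"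
  shows "finsum M c {\<sigma>. c \<sigma> \<noteq> \<zero>} = finsum M c I"
  using assms by (intro add.finprod_mono_neutral_cong_left) auto

lemma comp_unique:
  assumes "\<And>\<sigma>. \<sigma> \<in> carrier G \<Longrightarrow> c \<sigma> \<in> P \<sigma>" "\<And>\<sigma>. \<sigma> \<notin> carrier G \<Longrightarrow> c \<sigma> = \<zero>"
    and "finite I" "{\<sigma>. c \<sigma> \<noteq> \<zero>} \<subseteq> I"
  shows "comp (finsum M c I) = c"
proof -
  have car: "c \<sigma> \<in> carrier M" for \<sigma>
    using assms(1,2) part_carrier by (cases "\<sigma> \<in> carrier G") auto
  define x where "x = finsum M c I"
  have x: "x \<in> carrier M" unfolding x_def using car by (intro finsum_closed) auto
  have "finsum M c {\<sigma>. c \<sigma> \<noteq> \<zero>} = x"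
    unfolding x_def by (rule finsum_support) (use assms car in auto)
  moreover have "finite {\<sigma>. c \<sigma> \<noteq> \<zero>}" using assms finite_subset by blast
  moreover have "\<exists>!c. (\<forall>\<sigma>\<in>carrier G. c \<sigma> \<in> P \<sigma>) \<and> (\<forall>\<sigma>. \<sigma> \<notin> carrier G \<longrightarrow> c \<sigma> = \<zero>) \<and>
     finite {\<sigma>. c \<sigma> \<noteq> \<zero>} \<and> x = finsum M c {\<sigma>. c \<sigma> \<noteq> \<zero>}"
    using grading x unfolding is_grading_def by blast
  ultimately show ?thesis
    unfolding gr_comp_def x_def[symmetric] using assms(1,2) by (intro the1_equality) auto
qed

lemma comp_add:
  assumes "x \<in> carrier M" "y \<in> carrier M"
  shows "comp (x \<oplus> y) \<sigma> = comp x \<sigma> \<oplus> comp y \<sigma>"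
proof -
  let ?I = "{\<sigma>. comp x \<sigma> \<noteq> \<zero>} \<union> {\<sigma>. comp y \<sigma> \<noteq> \<zero>}"
  have fin: "finite ?I" using assms comp_spec(3) by blast
  have "finsum M (comp z) ?I = z" if "z \<in> {x, y}" for z
  proof -
    have "finsum M (comp z) {\<sigma>. comp z \<sigma> \<noteq> \<zero>} = finsum M (comp z) ?I"
      by (rule finsum_support) (use fin that assms comp_carrier in auto)
    then show ?thesis using comp_spec(4) assms that by auto
  qed
  then have "finsum M (\<lambda>\<sigma>. comp x \<sigma> \<oplus> comp y \<sigma>) ?I = x \<oplus> y"
    using assms comp_carrier by (subst finsum_addf) auto
  moreover have "comp (finsum M (\<lambda>\<sigma>. comp x \<sigma> \<oplus> comp y \<sigma>) ?I) = (\<lambda>\<sigma>. comp x \<sigma> \<oplus> comp y \<sigma>)"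
    by (rule comp_unique) (use assms fin comp_spec part_add in auto)
  ultimately show ?thesis by simp
qed

lemma comp_part:
  assumes "\<sigma> \<in> carrier G" "x \<in> P \<sigma>"
  shows "comp x \<rho> = (if \<rho> = \<sigma> then x else \<zero>)"
proof -
  have x: "x \<in> carrier M" using assms part_carrier by blast
  let ?c = "\<lambda>\<rho>. if \<rho> = \<sigma> then x else \<zero>"
  have "comp (finsum M ?c {\<sigma>}) = ?c"
    by (rule comp_unique) (use assms part_zero in auto)
  moreover have "finsum M ?c {\<sigma>} = x"
    using x finsum_insert[of "{}" \<sigma> ?c] by auto
  ultimately show ?thesis by simp
qed

text \<open>Every element is a finite sum of its components, so statements that pass to sums need
  checking on homogeneous elements only.\<close>

lemma graded_induct [consumes 1, case_names zero homog add]: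
  assumes "x \<in> carrier M"
    and zero: "Q \<zero>"
    and homog: "\<And>\<sigma> x. \<sigma> \<in> carrier G \<Longrightarrow> x \<in> P \<sigma> \<Longrightarrow> Q x"
    and add: "\<And>x y. x \<in> carrier M \<Longrightarrow> y \<in> carrier M \<Longrightarrow> Q x \<Longrightarrow> Q y \<Longrightarrow> Q (x \<oplus> y)"
  shows "Q x"
proof -
  have "Q (finsum M (comp x) I)" if "finite I" "I \<subseteq> carrier G" for I
    using that
  proof (induction I)
    case (insert \<sigma> I)
    then have "finsum M (comp x) (insert \<sigma> I) = comp x \<sigma> \<oplus> finsum M (comp x) I"
      using comp_carrier[OF assms(1)] by (intro finsum_insert) auto
    moreover have "finsum M (comp x) I \<in> carrier M"
      using comp_carrier[OF assms(1)] by (intro finsum_closed) auto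
    ultimately show ?case
      using insert assms(1) comp_carrier comp_spec(1) homog by (auto intro!: add)
  qed (simp add: zero)
  moreover have "{\<sigma>. comp x \<sigma> \<noteq> \<zero>} \<subseteq> carrier G"
    using comp_spec(2)[OF assms(1)] by blast
  ultimately show ?thesis using comp_spec(3,4)[OF assms(1)] by metis
qed

lemma comp_separates:
  assumes "x \<in> carrier M" "\<And>\<sigma>. \<sigma> \<in> carrier G \<Longrightarrow> comp x \<sigma> = \<zero>"
  shows "x = \<zero>"
proof -
  have "{\<sigma>. comp x \<sigma> \<noteq> \<zero>} = {}" using assms comp_spec(2) by blast
  then show ?thesis using comp_spec(4)[OF assms(1)] by (metis finsum_empty)
qed

lemma comp_finsum:
  assumes "finite K" "\<And>k. k \<in> K \<Longrightarrow> f k \<in> carrier M" "\<sigma> \<in> carrier G"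
  shows "comp (finsum M f K) \<sigma> = finsum M (\<lambda>k. comp (f k) \<sigma>) K"
  using assms(1,2)
proof (induction K)
  case empty
  then show ?case using comp_part[OF assms(3) part_zero[OF assms(3)]] by simp
next
  case (insert k K)
  then have "f \<in> K \<rightarrow> carrier M" "f k \<in> carrier M" by auto
  then show ?case using insert comp_carrier
    by (subst (1 2) finsum_insert) (auto simp: comp_add)
qed

end

lemma additive_zero:
  assumes "abelian_group M" "abelian_group N"
    and "f \<in> carrier M \<rightarrow> carrier N"
    and "\<And>x y. x \<in> carrier M \<Longrightarrow> y \<in> carrier M \<Longrightarrow> f (x \<oplus>\<^bsub>M\<^esub> y) = f x \<oplus>\<^bsub>N\<^esub> f y"
  shows "f \<zero>\<^bsub>M\<^esub> = \<zero>\<^bsub>N\<^esub>"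
proof -
  interpret M: abelian_group M by fact
  interpret N: abelian_group N by fact
  have "f \<zero>\<^bsub>M\<^esub> \<oplus>\<^bsub>N\<^esub> f \<zero>\<^bsub>M\<^esub> = f \<zero>\<^bsub>M\<^esub>" using assms(4)[of "\<zero>\<^bsub>M\<^esub>" "\<zero>\<^bsub>M\<^esub>"] by simp
  then show ?thesis using assms(3) by (intro N.additive_cancel_zero) auto
qed

text \<open>Injectivity of the degree shift \<open>s\<close> keeps different components apart. With
  \<open>s\<close> the identity this covers graded homomorphisms; with translations it covers
  multiplication by a homogeneous ring element, as in \<open>D_one\<close> and
  \<open>D_inverse\<close>.\<close>

lemma comp_additive_map:
  assumes "graded_group M G P" "graded_group N G Q"
    and f: "f \<in> carrier M \<rightarrow> carrier N"
      "\<And>x y. x \<in> carrier M \<Longrightarrow> y \<in> carrier M \<Longrightarrow> f (x \<oplus>\<^bsub>M\<^esub> y) = f x \<oplus>\<^bsub>N\<^esub> f y"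
    and s: "s \<in> carrier G \<rightarrow> carrier G" "inj_on s (carrier G)"
    and fs: "\<And>\<sigma> x. \<sigma> \<in> carrier G \<Longrightarrow> x \<in> P \<sigma> \<Longrightarrow> f x \<in> Q (s \<sigma>)"
    and x: "x \<in> carrier M" "\<sigma> \<in> carrier G"
  shows "gr_comp G N Q (f x) (s \<sigma>) = f (gr_comp G M P x \<sigma>)"
proof -
  interpret M: graded_group M G P by fact
  interpret N: graded_group N G Q by fact
  have f0: "f \<zero>\<^bsub>M\<^esub> = \<zero>\<^bsub>N\<^esub>"
    using additive_zero[OF M.abelian_group_axioms N.abelian_group_axioms f] by blast
  have s\<sigma>: "s \<sigma> \<in> carrier G" using s x by auto
  show ?thesis
    using x(1)
  proof (induction x rule: M.graded_induct)
    case zero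
    then show ?case
      using N.comp_part[OF s\<sigma> N.part_zero[OF s\<sigma>]] M.comp_part[OF x(2) M.part_zero[OF x(2)]]
      by (simp add: f0)
  next
    case (homog \<rho> x)
    have "s \<rho> \<in> carrier G" using homog s by auto
    moreover have "s \<sigma> = s \<rho> \<longleftrightarrow> \<sigma> = \<rho>" using s x homog by (auto dest: inj_onD)
    ultimately show ?case
      using N.comp_part[of "s \<rho>" "f x"] fs[of \<rho> x] M.comp_part[of \<rho> x] homog f0 by simp
  next
    case (add x y)
    then show ?case using f M.comp_carrier by (simp add: M.comp_add N.comp_add Pi_iff)
  qed
qed


section \<open>Graded modules\<close>

sublocale graded_left_module \<subseteq> gr?: graded_group M G "gr_part M"
  by unfold_locales (rule module_grading)

lemma (in left_module) smult_zero_right: "a \<in> carrier R \<Longrightarrow> a \<odot>\<^bsub>M\<^esub> \<zero>\<^bsub>M\<^esub> = \<zero>\<^bsub>M\<^esub>"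
  using additive_zero[OF M.abelian_group_axioms M.abelian_group_axioms, of "(\<odot>\<^bsub>M\<^esub>) a"]
  by (simp add: smult_closed smult_r_distr Pi_iff)

lemma (in left_module) smult_zero_left: "x \<in> carrier M \<Longrightarrow> \<zero>\<^bsub>R\<^esub> \<odot>\<^bsub>M\<^esub> x = \<zero>\<^bsub>M\<^esub>"
  using additive_zero[OF R.is_abelian_group M.abelian_group_axioms, of "\<lambda>a. a \<odot>\<^bsub>M\<^esub> x"]
  by (simp add: smult_closed smult_l_distr Pi_iff)

section \<open>Graded submodules and graded simplicity\<close>

lemma gr_restrict_simps [simp]:
  "carrier (gr_restrict M N) = N" "zero (gr_restrict M N) = zero M" "add (gr_restrict M N) = add M"
  "smult (gr_restrict M N) = smult M" "gr_part (gr_restrict M N) \<sigma> = N \<inter> gr_part M \<sigma>"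
  by (simp_all add: gr_restrict_def)

context graded_left_module
begin

lemma submoduleD:
  assumes "Module.submodule N R M"
  shows "N \<subseteq> carrier M" "\<zero>\<^bsub>M\<^esub> \<in> N"
    and "\<And>x y. x \<in> N \<Longrightarrow> y \<in> N \<Longrightarrow> x \<oplus>\<^bsub>M\<^esub> y \<in> N" "\<And>x. x \<in> N \<Longrightarrow> \<ominus>\<^bsub>M\<^esub> x \<in> N"
    and "\<And>a x. a \<in> carrier R \<Longrightarrow> x \<in> N \<Longrightarrow> a \<odot>\<^bsub>M\<^esub> x \<in> N"
proof -
  interpret sm: Module.submodule N R M by fact
  interpret s: additive_subgroup N M by (rule additive_subgroupI) (rule sm.subgroup_axioms)
  show "N \<subseteq> carrier M" "\<zero>\<^bsub>M\<^esub> \<in> N"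
    "\<And>x y. x \<in> N \<Longrightarrow> y \<in> N \<Longrightarrow> x \<oplus>\<^bsub>M\<^esub> y \<in> N" "\<And>a x. a \<in> carrier R \<Longrightarrow> x \<in> N \<Longrightarrow> a \<odot>\<^bsub>M\<^esub> x \<in> N"
    using s.a_subset by auto
  show "\<And>x. x \<in> N \<Longrightarrow> \<ominus>\<^bsub>M\<^esub> x \<in> N"
    using sm.m_inv_closed by (simp add: a_inv_def)
qed

lemma submodule_abelian_group:
  assumes "Module.submodule N R M"
  shows "abelian_group (gr_restrict M N)"
proof (rule abelian_groupI)
  note N = submoduleD[OF assms]
  fix x assume "x \<in> carrier (gr_restrict M N)"
  then have "\<ominus>\<^bsub>M\<^esub> x \<in> N" "\<ominus>\<^bsub>M\<^esub> x \<oplus>\<^bsub>M\<^esub> x = \<zero>\<^bsub>M\<^esub>" using N by (auto simp: M.l_neg)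
  then show "\<exists>y\<in>carrier (gr_restrict M N). y \<oplus>\<^bsub>gr_restrict M N\<^esub> x = \<zero>\<^bsub>gr_restrict M N\<^esub>" by auto
qed (use submoduleD[OF assms] in \<open>auto simp: M.a_ac subset_iff\<close>)

lemma additive_subgroup_restrict:
  assumes "Module.submodule N R M" "\<sigma> \<in> carrier G"
  shows "additive_subgroup (N \<inter> gr_part M \<sigma>) (gr_restrict M N)"
proof (intro additive_subgroupI group.subgroupI)
  interpret N: abelian_group "gr_restrict M N" using assms submodule_abelian_group by blast
  note N = submoduleD[OF assms(1)]
  show "group (add_monoid (gr_restrict M N))" by (rule N.a_group)
  fix x assume x: "x \<in> N \<inter> gr_part M \<sigma>"
  then have "\<ominus>\<^bsub>M\<^esub> x \<in> N" "\<ominus>\<^bsub>M\<^esub> x \<oplus>\<^bsub>M\<^esub> x = \<zero>\<^bsub>M\<^esub>" using N by (auto simp: M.l_neg)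
  then have "\<ominus>\<^bsub>gr_restrict M N\<^esub> x = \<ominus>\<^bsub>M\<^esub> x"
    using x by (intro N.minus_equality) auto
  then show "inv\<^bsub>add_monoid (gr_restrict M N)\<^esub> x \<in> N \<inter> gr_part M \<sigma>"
    using x N part_uminus assms by (simp add: a_inv_def)
qed (use submoduleD[OF assms(1)] part_zero part_add assms in auto)

text \<open>When \<open>N\<close> is closed under components, the projections of \<open>M\<close>
  restrict to \<open>N\<close>, and \<open>is_gradingI\<close> applies to them.\<close>

lemma gr_submoduleI:
  assumes "Module.submodule N R M" "\<And>x \<sigma>. x \<in> N \<Longrightarrow> \<sigma> \<in> carrier G \<Longrightarrow> gr.comp x \<sigma> \<in> N"
  shows "gr_submodule G R M N"
  unfolding gr_submodule_def
proof (intro conjI)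
  note N = submoduleD[OF assms(1)]
  have car: "x \<in> carrier M" if "x \<in> N" for x using that N by auto
  show "is_grading G (gr_restrict M N) (gr_part (gr_restrict M N))"
  proof (rule is_gradingI[where \<pi> = gr.comp])
    show "abelian_group (gr_restrict M N)" using assms submodule_abelian_group by blast
    show "\<And>\<sigma>. \<sigma> \<in> carrier G \<Longrightarrow> additive_subgroup (gr_part (gr_restrict M N) \<sigma>) (gr_restrict M N)"
      using additive_subgroup_restrict assms by simp
    show "\<And>x. x \<in> carrier (gr_restrict M N) \<Longrightarrow>
        finite {\<sigma> \<in> carrier G. gr.comp x \<sigma> \<noteq> \<zero>\<^bsub>gr_restrict M N\<^esub>}"
      using comp_spec(3)[OF car] by (auto intro: finite_subset[rotated])
    fix x assume "x \<in> carrier (gr_restrict M N)"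
      "\<And>\<sigma>. \<sigma> \<in> carrier G \<Longrightarrow> gr.comp x \<sigma> = \<zero>\<^bsub>gr_restrict M N\<^esub>"
    then show "x = \<zero>\<^bsub>gr_restrict M N\<^esub>" using comp_separates[of x] car by simp
  qed (simp_all add: assms(2) car comp_spec(1) comp_add comp_part)
qed fact

lemma gr_submoduleD:
  assumes "gr_submodule G R M N"
  shows "N \<subseteq> carrier M" "\<zero>\<^bsub>M\<^esub> \<in> N"
    and "\<And>x y. x \<in> N \<Longrightarrow> y \<in> N \<Longrightarrow> x \<oplus>\<^bsub>M\<^esub> y \<in> N" "\<And>x. x \<in> N \<Longrightarrow> \<ominus>\<^bsub>M\<^esub> x \<in> N"
    and "\<And>a x. a \<in> carrier R \<Longrightarrow> x \<in> N \<Longrightarrow> a \<odot>\<^bsub>M\<^esub> x \<in> N"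
proof -
  have "Module.submodule N R M" using assms by (simp add: gr_submodule_def)
  note N = submoduleD[OF this]
  show "N \<subseteq> carrier M" "\<zero>\<^bsub>M\<^esub> \<in> N" "\<And>x y. x \<in> N \<Longrightarrow> y \<in> N \<Longrightarrow> x \<oplus>\<^bsub>M\<^esub> y \<in> N"
    "\<And>x. x \<in> N \<Longrightarrow> \<ominus>\<^bsub>M\<^esub> x \<in> N" "\<And>a x. a \<in> carrier R \<Longrightarrow> x \<in> N \<Longrightarrow> a \<odot>\<^bsub>M\<^esub> x \<in> N"
    by (fact N)+
qed

lemma graded_left_module_restrict:
  assumes "gr_submodule G R M N" "\<And>\<sigma>. \<sigma> \<in> carrier G \<Longrightarrow> P \<sigma> \<subseteq> carrier R"
  shows "graded_left_module G R P (gr_restrict M N)"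
proof -
  interpret N: abelian_group "gr_restrict M N"
    using assms submodule_abelian_group unfolding gr_submodule_def by blast
  note N = gr_submoduleD[OF assms(1)]
  have car: "x \<in> carrier M" if "x \<in> N" for x using that N(1) by blast
  show ?thesis
  proof unfold_locales
    show "is_grading G (gr_restrict M N) (gr_part (gr_restrict M N))"
      using assms by (simp add: gr_submodule_def)
  qed (simp_all add: N(5) car smult_l_distr smult_r_distr smult_assoc smult_one smult_graded N(5)[OF subsetD[OF assms(2)]])
qed

text \<open>Converse of \<open>gr_submoduleI\<close>, by induction along the grading of
  \<open>N\<close>, whose homogeneous elements are homogeneous in \<open>M\<close>.\<close>

lemma comp_gr_submodule:
  assumes "gr_submodule G R M N" "x \<in> N" "\<sigma> \<in> carrier G"
  shows "gr.comp x \<sigma> \<in> N"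
proof -
  interpret N: abelian_group "gr_restrict M N"
    using assms(1) submodule_abelian_group unfolding gr_submodule_def by blast
  interpret N: graded_group "gr_restrict M N" G "gr_part (gr_restrict M N)"
    using assms(1) by unfold_locales (simp add: gr_submodule_def)
  note N = gr_submoduleD[OF assms(1)]
  have "x \<in> carrier (gr_restrict M N)" using assms by simp
  then show ?thesis
  proof (induction x rule: N.graded_induct)
    case zero
    then show ?case using comp_part[OF assms(3) part_zero[OF assms(3)]] N by simp
  next
    case (homog \<rho> x)
    then show ?case using comp_part[of \<rho> x \<sigma>] N by simp
  next
    case (add x y)
    then show ?case using N by (simp add: comp_add subset_iff)
  qed
qed

text \<open>A nonzero graded submodule contains a nonzero homogeneous element, namely a component of
  one of its nonzero elements, so only homogeneous elements have to generate the module.\<close>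

lemma gr_simpleI:
  assumes "carrier M \<noteq> {\<zero>\<^bsub>M\<^esub>}"
    and gen: "\<And>\<sigma> x y. \<sigma> \<in> carrier G \<Longrightarrow> x \<in> gr_part M \<sigma> \<Longrightarrow> x \<noteq> \<zero>\<^bsub>M\<^esub> \<Longrightarrow> y \<in> carrier M \<Longrightarrow>
      \<exists>a\<in>carrier R. y = a \<odot>\<^bsub>M\<^esub> x"
  shows "gr_simple G R P M"
  unfolding gr_simple_def
proof (intro conjI allI impI)
  fix N assume N: "gr_submodule G R M N"
  show "N = {\<zero>\<^bsub>M\<^esub>} \<or> N = carrier M"
  proof (rule disjCI)
    assume "N \<noteq> carrier M"
    have "x = \<zero>\<^bsub>M\<^esub>" if x: "x \<in> N" for x
    proof (rule comp_separates)
      show "x \<in> carrier M" using x gr_submoduleD[OF N] by blast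
      fix \<sigma> assume \<sigma>: "\<sigma> \<in> carrier G"
      show "gr.comp x \<sigma> = \<zero>\<^bsub>M\<^esub>"
      proof (rule ccontr)
        assume nz: "gr.comp x \<sigma> \<noteq> \<zero>\<^bsub>M\<^esub>"
        have "carrier M \<subseteq> N"
        proof
          fix y assume "y \<in> carrier M"
          then obtain a where "a \<in> carrier R" "y = a \<odot>\<^bsub>M\<^esub> gr.comp x \<sigma>"
            using gen[OF \<sigma> comp_spec(1)[OF \<open>x \<in> carrier M\<close> \<sigma>] nz] by blast
          then show "y \<in> N" using comp_gr_submodule[OF N x \<sigma>] gr_submoduleD(5)[OF N] by blast
        qed
        then show False using \<open>N \<noteq> carrier M\<close> gr_submoduleD(1)[OF N] by blast
      qed
    qed
    then show "N = {\<zero>\<^bsub>M\<^esub>}" using gr_submoduleD(2)[OF N] by blast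
  qed
qed (use assms in \<open>simp_all add: graded_left_module_axioms\<close>)

end

section \<open>Graded homomorphisms, isomorphisms and images\<close>

lemma gr_homD:
  assumes "f \<in> gr_hom G R M N"
  shows "x \<in> carrier M \<Longrightarrow> f x \<in> carrier N"
    and "x \<in> carrier M \<Longrightarrow> y \<in> carrier M \<Longrightarrow> f (x \<oplus>\<^bsub>M\<^esub> y) = f x \<oplus>\<^bsub>N\<^esub> f y"
    and "a \<in> carrier R \<Longrightarrow> x \<in> carrier M \<Longrightarrow> f (a \<odot>\<^bsub>M\<^esub> x) = a \<odot>\<^bsub>N\<^esub> f x"
    and "\<sigma> \<in> carrier G \<Longrightarrow> x \<in> gr_part M \<sigma> \<Longrightarrow> f x \<in> gr_part N \<sigma>"
  using assms unfolding gr_hom_def by blast+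

lemma gr_homI:
  assumes "\<And>x. x \<in> carrier M \<Longrightarrow> f x \<in> carrier N"
    and "\<And>x y. x \<in> carrier M \<Longrightarrow> y \<in> carrier M \<Longrightarrow> f (x \<oplus>\<^bsub>M\<^esub> y) = f x \<oplus>\<^bsub>N\<^esub> f y"
    and "\<And>a x. a \<in> carrier R \<Longrightarrow> x \<in> carrier M \<Longrightarrow> f (a \<odot>\<^bsub>M\<^esub> x) = a \<odot>\<^bsub>N\<^esub> f x"
    and "\<And>\<sigma> x. \<sigma> \<in> carrier G \<Longrightarrow> x \<in> gr_part M \<sigma> \<Longrightarrow> f x \<in> gr_part N \<sigma>"
  shows "f \<in> gr_hom G R M N"
  using assms unfolding gr_hom_def by blast

lemma gr_hom_compose:
  assumes "f \<in> gr_hom G R L M" "h \<in> gr_hom G R M N"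
  shows "(\<lambda>x. h (f x)) \<in> gr_hom G R L N"
  using gr_homD[OF assms(1)] gr_homD[OF assms(2)] by (intro gr_homI) auto

lemma gr_iso_refl: "gr_iso G R M M"
  unfolding gr_iso_def by (rule bexI[of _ "\<lambda>x. x"]) (auto intro: gr_homI simp: bij_betw_def)

lemma gr_iso_trans: "gr_iso G R L M \<Longrightarrow> gr_iso G R M N \<Longrightarrow> gr_iso G R L N"
  unfolding gr_iso_def using gr_hom_compose bij_betw_trans[unfolded comp_def] by fast

lemma gr_hom_zero:
  assumes "graded_left_module G R P M" "graded_left_module G R P N" "f \<in> gr_hom G R M N"
  shows "f \<zero>\<^bsub>M\<^esub> = \<zero>\<^bsub>N\<^esub>"
proof -
  interpret M: graded_left_module G R P M by fact
  interpret N: graded_left_module G R P N by fact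
  show ?thesis
    using gr_homD[OF assms(3)]
    by (intro additive_zero[OF M.abelian_group_axioms N.abelian_group_axioms]) auto
qed

lemma gr_hom_comp:
  assumes "graded_left_module G R P M" "graded_left_module G R P N" "f \<in> gr_hom G R M N"
    and "x \<in> carrier M" "\<sigma> \<in> carrier G"
  shows "gr_comp G N (gr_part N) (f x) \<sigma> = f (gr_comp G M (gr_part M) x \<sigma>)"
proof -
  interpret M: graded_left_module G R P M by fact
  interpret N: graded_left_module G R P N by fact
  show ?thesis
    using comp_additive_map[OF M.graded_group_axioms N.graded_group_axioms, of f "\<lambda>x. x" x \<sigma>]
      gr_homD[OF assms(3)] assms(4,5) by auto
qed

text \<open>The components of a kernel element lie in the kernel again, so a nonzero kernel is
  already visible in some degree.\<close>

lemma gr_hom_inj: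
  assumes "graded_left_module G R P M" "graded_left_module G R P N" "f \<in> gr_hom G R M N"
    and "\<And>\<sigma> x. \<sigma> \<in> carrier G \<Longrightarrow> x \<in> gr_part M \<sigma> \<Longrightarrow> f x = \<zero>\<^bsub>N\<^esub> \<Longrightarrow> x = \<zero>\<^bsub>M\<^esub>"
  shows "inj_on f (carrier M)"
proof (rule inj_onI)
  interpret M: graded_left_module G R P M by fact
  interpret N: graded_left_module G R P N by fact
  note f = gr_homD[OF assms(3)]
  have ker: "x = \<zero>\<^bsub>M\<^esub>" if "x \<in> carrier M" "f x = \<zero>\<^bsub>N\<^esub>" for x
  proof (rule M.comp_separates[OF that(1)])
    fix \<sigma> assume \<sigma>: "\<sigma> \<in> carrier G"
    have "f (M.gr.comp x \<sigma>) = \<zero>\<^bsub>N\<^esub>"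
      using gr_hom_comp[OF assms(1-3) that(1) \<sigma>] that(2) N.comp_part[OF \<sigma> N.part_zero[OF \<sigma>]] by simp
    then show "M.gr.comp x \<sigma> = \<zero>\<^bsub>M\<^esub>" using assms(4)[OF \<sigma>] M.comp_spec(1)[OF that(1) \<sigma>] by blast
  qed
  fix x y assume xy: "x \<in> carrier M" "y \<in> carrier M" "f x = f y"
  let ?z = "x \<oplus>\<^bsub>M\<^esub> \<ominus>\<^bsub>M\<^esub> y"
  have z: "?z \<in> carrier M" "?z \<oplus>\<^bsub>M\<^esub> y = x" using xy by (simp_all add: M.a_assoc M.l_neg)
  have "f ?z \<oplus>\<^bsub>N\<^esub> f y = f y" using f(2)[OF z(1) xy(2)] z xy by simp
  then have "f ?z = \<zero>\<^bsub>N\<^esub>" using f(1) z xy by (metis N.add.r_cancel_one)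
  then have "?z = \<zero>\<^bsub>M\<^esub>" using ker z by blast
  then show "x = y" using z xy by simp
qed

text \<open>\<open>f\<close> commutes with components, so \<open>x\<close> and its component of
  degree \<sigma> have the same image. This makes the inverse of a graded isomorphism preserve
  degrees.\<close>

lemma gr_hom_part_preimage:
  assumes "graded_left_module G R P M" "graded_left_module G R P N" "f \<in> gr_hom G R M N"
    and "inj_on f (carrier M)" "x \<in> carrier M" "\<sigma> \<in> carrier G" "f x \<in> gr_part N \<sigma>"
  shows "x \<in> gr_part M \<sigma>"
proof -
  interpret M: graded_left_module G R P M by fact
  interpret N: graded_left_module G R P N by fact
  have "f (M.gr.comp x \<sigma>) = f x"
    using gr_hom_comp[OF assms(1-3,5,6)] N.comp_part[OF assms(6,7)] by simp
  then have "M.gr.comp x \<sigma> = x"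
    using assms(4,5) M.comp_carrier by (auto dest: inj_onD)
  then show ?thesis using M.comp_spec(1)[OF assms(5,6)] by simp
qed

lemma gr_iso_sym:
  assumes "graded_left_module G R P M" "graded_left_module G R P N" "gr_iso G R M N"
  shows "gr_iso G R N M"
proof -
  interpret M: graded_left_module G R P M by fact
  interpret N: graded_left_module G R P N by fact
  obtain f where f: "f \<in> gr_hom G R M N" "bij_betw f (carrier M) (carrier N)"
    using assms(3) unfolding gr_iso_def by blast
  let ?h = "inv_into (carrier M) f"
  have inj: "inj_on f (carrier M)" using f by (simp add: bij_betw_def)
  have h: "?h x \<in> carrier M" "f (?h x) = x" if "x \<in> carrier N" for x
    using that f(2) by (auto simp: bij_betw_def inv_into_into f_inv_into_f)
  have eq: "?h y = x" if "x \<in> carrier M" "f x = y" for x y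
    using that inj by auto
  have "?h \<in> gr_hom G R N M"
  proof (rule gr_homI)
    fix x y assume "x \<in> carrier N" "y \<in> carrier N"
    then show "?h (x \<oplus>\<^bsub>N\<^esub> y) = ?h x \<oplus>\<^bsub>M\<^esub> ?h y" using h gr_homD[OF f(1)] by (intro eq) auto
  next
    fix a x assume "a \<in> carrier R" "x \<in> carrier N"
    then show "?h (a \<odot>\<^bsub>N\<^esub> x) = a \<odot>\<^bsub>M\<^esub> ?h x"
      using h gr_homD[OF f(1)] M.smult_closed by (intro eq) auto
  next
    fix \<sigma> x assume \<sigma>: "\<sigma> \<in> carrier G" "x \<in> gr_part N \<sigma>"
    then have "x \<in> carrier N" using N.part_carrier by blast
    then show "?h x \<in> gr_part M \<sigma>"
      using gr_hom_part_preimage[OF assms(1,2) f(1) inj] h \<sigma> by auto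
  qed (use h in auto)
  then show ?thesis unfolding gr_iso_def using f(2) bij_betw_inv_into by blast
qed

lemma gr_hom_image:
  assumes "graded_left_module G R P M" "graded_left_module G R P N" "f \<in> gr_hom G R M N"
  shows "gr_submodule G R N (f ` carrier M)"
proof -
  interpret M: graded_left_module G R P M by fact
  interpret N: graded_left_module G R P N by fact
  note f = gr_homD[OF assms(3)] and f0 = gr_hom_zero[OF assms]
  show ?thesis
  proof (rule N.gr_submoduleI)
    show "Module.submodule (f ` carrier M) R N"
    proof (intro Module.submodule.intro submodule_axioms.intro group.subgroupI)
      show "group (add_monoid N)" by (rule N.a_group)
      show "f ` carrier M \<subseteq> carrier (add_monoid N)" using f(1) by auto
      show "f ` carrier M \<noteq> {}" using M.zero_closed by blast
    next
      fix y assume "y \<in> f ` carrier M"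
      then obtain x where x: "x \<in> carrier M" "y = f x" by blast
      have "f (\<ominus>\<^bsub>M\<^esub> x) \<oplus>\<^bsub>N\<^esub> f x = \<zero>\<^bsub>N\<^esub>"
        using f(2)[of "\<ominus>\<^bsub>M\<^esub> x" x] x f0 by (simp add: M.l_neg)
      then have "\<ominus>\<^bsub>N\<^esub> y = f (\<ominus>\<^bsub>M\<^esub> x)" using x f(1) by (intro N.minus_equality) auto
      then show "inv\<^bsub>add_monoid N\<^esub> y \<in> f ` carrier M" using x by (auto simp: a_inv_def)
    next
      fix y z assume "y \<in> f ` carrier M" "z \<in> f ` carrier M"
      then show "y \<otimes>\<^bsub>add_monoid N\<^esub> z \<in> f ` carrier M"
        by (auto simp flip: f(2))
    next
      fix a y assume "a \<in> carrier R" "y \<in> f ` carrier M"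
      then show "a \<odot>\<^bsub>N\<^esub> y \<in> f ` carrier M"
        by (auto simp: M.smult_closed simp flip: f(3))
    qed
    fix y \<sigma> assume "y \<in> f ` carrier M" "\<sigma> \<in> carrier G"
    then show "N.gr.comp y \<sigma> \<in> f ` carrier M"
      using gr_hom_comp[OF assms] M.comp_carrier by auto
  qed
qed

lemma gr_hom_restrict:
  assumes "graded_left_module G R P M" "f \<in> gr_hom G R M N" "f ` carrier M \<subseteq> S"
  shows "f \<in> gr_hom G R M (gr_restrict N S)"
proof -
  interpret M: graded_left_module G R P M by fact
  show ?thesis
    using gr_homD[OF assms(2)] assms(3) M.part_carrier by (intro gr_homI) auto
qed

lemma gr_hom_inclusion: "S \<subseteq> carrier M \<Longrightarrow> (\<lambda>x. x) \<in> gr_hom G R (gr_restrict M S) M"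
  by (intro gr_homI) auto

lemma gr_iso_image:
  assumes "graded_left_module G R P M" "f \<in> gr_hom G R M N" "inj_on f (carrier M)"
  shows "gr_iso G R M (gr_restrict N (f ` carrier M))"
  unfolding gr_iso_def using gr_hom_restrict[OF assms(1,2) subset_refl] assms(3)
  by (auto simp: bij_betw_def)

text \<open>The fields \<open>mult\<close> and \<open>one\<close> are junk.\<close>

definition gr_transport :: "('b \<Rightarrow> 'c) \<Rightarrow> ('a, 'b, 'g) gr_module \<Rightarrow> ('a, 'c, 'g) gr_module" where
  "gr_transport \<phi> M = (let \<psi> = inv_into (carrier M) \<phi> in
     \<lparr>carrier = \<phi> ` carrier M, mult = (\<lambda>x y. x), one = \<phi> \<zero>\<^bsub>M\<^esub>, zero = \<phi> \<zero>\<^bsub>M\<^esub>,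
      add = (\<lambda>x y. \<phi> (\<psi> x \<oplus>\<^bsub>M\<^esub> \<psi> y)), smult = (\<lambda>a x. \<phi> (a \<odot>\<^bsub>M\<^esub> \<psi> x)),
      gr_part = (\<lambda>\<sigma>. \<phi> ` gr_part M \<sigma>)\<rparr>)"

lemma gr_transport_simps [simp]:
  "carrier (gr_transport \<phi> M) = \<phi> ` carrier M" "zero (gr_transport \<phi> M) = \<phi> (zero M)"
  "gr_part (gr_transport \<phi> M) \<sigma> = \<phi> ` gr_part M \<sigma>"
  by (simp_all add: gr_transport_def Let_def)

text \<open>Carries a module over to another element type, so that copies of the column modules can
  be found in the universe \<open>'m\<close>. The projections of the copy are those of
  \<open>M\<close> conjugated by \<phi>.\<close>

lemma gr_transport:
  assumes "graded_left_module G R P M" "inj_on \<phi> (carrier M)"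
  shows "graded_left_module G R P (gr_transport \<phi> M)" "gr_iso G R M (gr_transport \<phi> M)"
proof -
  interpret M: graded_left_module G R P M by fact
  let ?N = "gr_transport \<phi> M"
  note car = M.part_carrier
  have add: "\<phi> x \<oplus>\<^bsub>?N\<^esub> \<phi> y = \<phi> (x \<oplus>\<^bsub>M\<^esub> y)" if "x \<in> carrier M" "y \<in> carrier M" for x y
    using that assms(2) by (simp add: gr_transport_def Let_def)
  have smult: "a \<odot>\<^bsub>?N\<^esub> \<phi> x = \<phi> (a \<odot>\<^bsub>M\<^esub> x)" if "x \<in> carrier M" for a x
    using that assms(2) by (simp add: gr_transport_def Let_def)
  have inj: "\<phi> x = \<phi> y \<longleftrightarrow> x = y" if "x \<in> carrier M" "y \<in> carrier M" for x y
    using that assms(2) by (auto dest: inj_onD)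
  have neg: "\<phi> (\<ominus>\<^bsub>M\<^esub> x) \<oplus>\<^bsub>?N\<^esub> \<phi> x = \<zero>\<^bsub>?N\<^esub>" if "x \<in> carrier M" for x
    using that by (simp add: add M.l_neg)
  interpret N: abelian_group ?N
  proof (rule abelian_groupI)
    fix x assume "x \<in> carrier ?N"
    then obtain x' where "x' \<in> carrier M" "x = \<phi> x'" by auto
    then show "\<exists>y\<in>carrier ?N. y \<oplus>\<^bsub>?N\<^esub> x = \<zero>\<^bsub>?N\<^esub>"
      using neg by (intro bexI[of _ "\<phi> (\<ominus>\<^bsub>M\<^esub> x')"]) auto
  qed (auto simp: add M.a_ac)
  have uminus: "\<ominus>\<^bsub>?N\<^esub> \<phi> x = \<phi> (\<ominus>\<^bsub>M\<^esub> x)" if "x \<in> carrier M" for x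
    using that neg by (intro N.minus_equality) auto
  let ?\<psi> = "inv_into (carrier M) \<phi>"
  have \<psi>: "?\<psi> (\<phi> x) = x" if "x \<in> carrier M" for x
    using that assms(2) by simp
  have part_iff: "\<phi> x \<in> \<phi> ` gr_part M \<sigma> \<longleftrightarrow> x \<in> gr_part M \<sigma>"
    if "x \<in> carrier M" "\<sigma> \<in> carrier G" for x \<sigma>
    using that inj car by blast
  have grading: "is_grading G ?N (gr_part ?N)"
  proof (rule is_gradingI[where \<pi> = "\<lambda>x \<sigma>. \<phi> (M.gr.comp (?\<psi> x) \<sigma>)"])
    fix \<sigma> assume \<sigma>: "\<sigma> \<in> carrier G"
    show "additive_subgroup (gr_part ?N \<sigma>) ?N"
    proof (intro additive_subgroupI group.subgroupI)
      show "group (add_monoid ?N)" by (rule N.a_group)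
      show "gr_part ?N \<sigma> \<subseteq> carrier (add_monoid ?N)" using car[OF \<sigma>] by auto
      show "gr_part ?N \<sigma> \<noteq> {}" using M.part_zero[OF \<sigma>] by auto
    next
      fix x assume "x \<in> gr_part ?N \<sigma>"
      then have "\<ominus>\<^bsub>?N\<^esub> x \<in> gr_part ?N \<sigma>" using car[OF \<sigma>] M.part_uminus[OF \<sigma>] by (auto simp: uminus)
      then show "inv\<^bsub>add_monoid ?N\<^esub> x \<in> gr_part ?N \<sigma>" by (simp add: a_inv_def)
    next
      fix x y assume "x \<in> gr_part ?N \<sigma>" "y \<in> gr_part ?N \<sigma>"
      then show "x \<otimes>\<^bsub>add_monoid ?N\<^esub> y \<in> gr_part ?N \<sigma>"
        using car[OF \<sigma>] M.part_add[OF \<sigma>] by (auto simp: add)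
    qed
  next
    fix x y \<sigma> assume "x \<in> carrier ?N" "y \<in> carrier ?N" "\<sigma> \<in> carrier G"
    then show "\<phi> (M.gr.comp (?\<psi> (x \<oplus>\<^bsub>?N\<^esub> y)) \<sigma>) =
        \<phi> (M.gr.comp (?\<psi> x) \<sigma>) \<oplus>\<^bsub>?N\<^esub> \<phi> (M.gr.comp (?\<psi> y) \<sigma>)"
      by (auto simp: add \<psi> M.comp_add M.comp_carrier)
  next
    fix x \<sigma> \<rho> assume "\<sigma> \<in> carrier G" "\<rho> \<in> carrier G" "x \<in> gr_part ?N \<sigma>"
    then show "\<phi> (M.gr.comp (?\<psi> x) \<rho>) = (if \<rho> = \<sigma> then x else \<zero>\<^bsub>?N\<^esub>)"
      using car by (auto simp: \<psi> M.comp_part)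
  next
    fix x assume "x \<in> carrier ?N"
    then obtain x' where x: "x' \<in> carrier M" "x = \<phi> x'" by auto
    show "finite {\<sigma> \<in> carrier G. \<phi> (M.gr.comp (?\<psi> x) \<sigma>) \<noteq> \<zero>\<^bsub>?N\<^esub>}"
      by (rule finite_subset[OF _ M.comp_spec(3)[OF x(1)]]) (auto simp: x \<psi>)
    assume "\<And>\<sigma>. \<sigma> \<in> carrier G \<Longrightarrow> \<phi> (M.gr.comp (?\<psi> x) \<sigma>) = \<zero>\<^bsub>?N\<^esub>"
    then show "x = \<zero>\<^bsub>?N\<^esub>"
      using x inj M.comp_carrier M.comp_separates[OF x(1)] by (simp add: \<psi>)
  next
    show "abelian_group ?N" by (rule N.abelian_group_axioms)
  qed (auto simp: \<psi> M.comp_spec(1))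
  show "graded_left_module G R P ?N"
  proof unfold_locales
    fix \<sigma> \<tau> a x assume *: "\<sigma> \<in> carrier G" "\<tau> \<in> carrier G" "a \<in> P \<sigma>" "x \<in> gr_part ?N \<tau>"
    then show "a \<odot>\<^bsub>?N\<^esub> x \<in> gr_part ?N (\<sigma> \<otimes>\<^bsub>G\<^esub> \<tau>)"
      using car M.smult_graded by (auto simp: smult)
  qed (use grading in \<open>auto simp: add smult M.smult_closed M.smult_l_distr M.smult_r_distr
        M.smult_assoc M.smult_one\<close>)
  show "gr_iso G R M ?N"
    unfolding gr_iso_def
    using assms(2) by (intro bexI[of _ \<phi>] gr_homI) (auto simp: bij_betw_def add smult)
qed


section \<open>Linear dependence over a division ring\<close>

text \<open>Gaussian elimination with unknowns on the left, over a division ring \<open>D\<close>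
  given as a subset of \<open>'d\<close>. Induction on the equations: one with zero coefficients is
  dropped, any other is removed together with a pivot unknown \<open>k0\<close>.\<close>

lemma underdetermined_system:
  fixes D :: "'d::ring_1 set" and c :: "'k \<Rightarrow> 'j \<Rightarrow> 'd"
  assumes D: "0 \<in> D" "1 \<in> D" "\<And>x y. x \<in> D \<Longrightarrow> y \<in> D \<Longrightarrow> x + y \<in> D"
      "\<And>x. x \<in> D \<Longrightarrow> - x \<in> D" "\<And>x y. x \<in> D \<Longrightarrow> y \<in> D \<Longrightarrow> x * y \<in> D"
      "\<And>x. x \<in> D \<Longrightarrow> x \<noteq> 0 \<Longrightarrow> \<exists>y\<in>D. y * x = 1"
    and nontriv: "(1::'d) \<noteq> 0"
    and "finite J" "finite K" "card J < card K" "\<And>k j. k \<in> K \<Longrightarrow> j \<in> J \<Longrightarrow> c k j \<in> D"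
  shows "\<exists>x. (\<forall>k\<in>K. x k \<in> D) \<and> (\<exists>k\<in>K. x k \<noteq> 0) \<and> (\<forall>j\<in>J. (\<Sum>k\<in>K. x k * c k j) = 0)"
  using assms(8-)
proof (induction J arbitrary: K c)
  case empty
  then obtain k where "k \<in> K" by fastforce
  then show ?case using D(2) nontriv by (intro exI[of _ "\<lambda>_. 1"]) auto
next
  case (insert j J)
  have Dsum: "sum f S \<in> D" if "\<And>s. s \<in> S \<Longrightarrow> f s \<in> D" for f :: "'k \<Rightarrow> 'd" and S
    using that by (induction S rule: infinite_finite_induct) (auto simp: D)
  show ?case
  proof (cases "\<forall>k\<in>K. c k j = 0")
    case True
    have "\<exists>x. (\<forall>k\<in>K. x k \<in> D) \<and> (\<exists>k\<in>K. x k \<noteq> 0) \<and> (\<forall>j\<in>J. (\<Sum>k\<in>K. x k * c k j) = 0)"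
      using insert by (intro insert.IH) auto
    then show ?thesis using True by auto
  next
    case False
    then obtain k0 u where k0: "k0 \<in> K" "c k0 j \<noteq> 0" and u: "u \<in> D" "u * c k0 j = 1"
      using D(6) insert.prems(3) by blast
    define K' where "K' = K - {k0}"
    \<comment> \<open>Row \<open>k\<close> minus a left multiple of the pivot row. As
      \<open>u\<close> is a left inverse of \<open>c k0 j\<close>, this clears column
      \<open>j\<close>.\<close>
    define c' where "c' = (\<lambda>k l. c k l + - (c k j * u * c k0 l))"
    have K': "finite K'" "card J < card K'" "K = insert k0 K'" "k0 \<notin> K'"
      using insert k0 by (auto simp: K'_def)
    have "\<exists>x. (\<forall>k\<in>K'. x k \<in> D) \<and> (\<exists>k\<in>K'. x k \<noteq> 0) \<and> (\<forall>j\<in>J. (\<Sum>k\<in>K'. x k * c' k j) = 0)"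
    proof (rule insert.IH[OF K'(1,2)])
      fix k l assume "k \<in> K'" "l \<in> J"
      then have "c k l \<in> D" "c k j \<in> D" "c k0 l \<in> D" using insert.prems(3) K'(3) by blast+
      then show "c' k l \<in> D" unfolding c'_def using u by (intro D) auto
    qed
    then obtain x where x: "\<forall>k\<in>K'. x k \<in> D" "\<exists>k\<in>K'. x k \<noteq> 0"
      "\<forall>l\<in>J. (\<Sum>k\<in>K'. x k * c' k l) = 0" by blast
    \<comment> \<open>With \<open>- t\<close> as the value at \<open>k0\<close>, the original
      combination of rows equals the combination of the eliminated rows.\<close>
    define t where "t = (\<Sum>k\<in>K'. x k * c k j) * u"
    have t: "t \<in> D" unfolding t_def
      using x(1) u insert.prems(3) K'(3) by (intro D(5) Dsum) auto
    let ?x = "x(k0 := - t)"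
    have eq: "(\<Sum>k\<in>K. ?x k * c k l) = (\<Sum>k\<in>K'. x k * c' k l)" for l
    proof -
      have "(\<Sum>k\<in>K. ?x k * c k l) = - t * c k0 l + (\<Sum>k\<in>K'. x k * c k l)"
        using K' by (auto intro!: sum.cong)
      also have "\<dots> = (\<Sum>k\<in>K'. x k * c' k l)"
        by (simp add: c'_def t_def algebra_simps sum_subtractf sum_distrib_right sum_distrib_left)
      finally show ?thesis .
    qed
    have "c' k j = 0" for k using u by (simp add: c'_def mult.assoc)
    then have "\<forall>l\<in>insert j J. (\<Sum>k\<in>K. ?x k * c k l) = 0" using x(3) eq by simp
    moreover have "\<forall>k\<in>K. ?x k \<in> D" using x(1) t D(4) K'(3) by auto
    moreover have "\<exists>k\<in>K. ?x k \<noteq> 0" using x(2) K'(3,4) by auto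
    ultimately show ?thesis by blast
  qed
qed

text \<open>Steinitz in coordinates: with too many vectors, the system formed by their coefficients
  has a nontrivial solution, which is a linear relation. Only the scalars come from
  \<open>D\<close>; the coordinates \<open>s k l\<close> and \<open>r j l\<close> may be any
  elements of \<open>'d\<close>, as rows with entries of different degrees require.\<close>

lemma card_independent_le_spanning:
  fixes D :: "'d::ring_1 set" and s :: "'k \<Rightarrow> 'l \<Rightarrow> 'd" and r :: "'j \<Rightarrow> 'l \<Rightarrow> 'd"
  assumes D: "0 \<in> D" "1 \<in> D" "\<And>x y. x \<in> D \<Longrightarrow> y \<in> D \<Longrightarrow> x + y \<in> D"
      "\<And>x. x \<in> D \<Longrightarrow> - x \<in> D" "\<And>x y. x \<in> D \<Longrightarrow> y \<in> D \<Longrightarrow> x * y \<in> D"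
      "\<And>x. x \<in> D \<Longrightarrow> x \<noteq> 0 \<Longrightarrow> \<exists>y\<in>D. y * x = 1"
    and nontriv: "(1::'d) \<noteq> 0"
    and fin: "finite J" "finite K"
    and span: "\<And>k. k \<in> K \<Longrightarrow> \<exists>c. (\<forall>j\<in>J. c j \<in> D) \<and> (\<forall>l\<in>L. s k l = (\<Sum>j\<in>J. c j * r j l))"
    and indep: "\<And>x k. (\<And>k. k \<in> K \<Longrightarrow> x k \<in> D) \<Longrightarrow> (\<And>l. l \<in> L \<Longrightarrow> (\<Sum>k\<in>K. x k * s k l) = 0) \<Longrightarrow>
      k \<in> K \<Longrightarrow> x k = 0"
  shows "card K \<le> card J"
proof (rule ccontr)
  assume "\<not> card K \<le> card J"
  obtain c where c: "\<And>k j. k \<in> K \<Longrightarrow> j \<in> J \<Longrightarrow> c k j \<in> D"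
    "\<And>k l. k \<in> K \<Longrightarrow> l \<in> L \<Longrightarrow> s k l = (\<Sum>j\<in>J. c k j * r j l)"
    using span by metis
  obtain x where x: "\<forall>k\<in>K. x k \<in> D" "\<exists>k\<in>K. x k \<noteq> 0" "\<forall>j\<in>J. (\<Sum>k\<in>K. x k * c k j) = 0"
    using underdetermined_system[OF D nontriv fin, of c] c(1) \<open>\<not> card K \<le> card J\<close> by auto
  have "(\<Sum>k\<in>K. x k * s k l) = 0" if "l \<in> L" for l
  proof -
    have "(\<Sum>k\<in>K. x k * s k l) = (\<Sum>k\<in>K. \<Sum>j\<in>J. x k * c k j * r j l)"
      using c(2) that by (simp add: sum_distrib_left mult.assoc)
    also have "\<dots> = (\<Sum>j\<in>J. \<Sum>k\<in>K. x k * c k j * r j l)" by (rule sum.swap)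
    also have "\<dots> = 0" using x(3) by (simp flip: sum_distrib_right)
    finally show ?thesis .
  qed
  then show False using indep[of x] x(1,2) by blast
qed


section \<open>Graded division rings\<close>

locale graded_division = group G for G (structure) +
  fixes \<Delta> :: "'a \<Rightarrow> 'd::ring_1 set"
  assumes graded_division: "graded_division_ring G (class_ring :: 'd ring) \<Delta>"
begin

sublocale D: graded_group "class_ring :: 'd ring" G \<Delta>
proof -
  have "ring (class_ring :: 'd ring)" "is_grading G (class_ring :: 'd ring) \<Delta>"
    using graded_division by (simp_all add: graded_division_ring_def graded_ring_def)
  then show "graded_group (class_ring :: 'd ring) G \<Delta>"
    by (simp add: graded_group_def graded_group_axioms_def ring_def)
qed

lemma nontriv: "(1::'d) \<noteq> 0"
  using graded_division by (simp add: graded_division_ring_def)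

lemma D_zero: "\<sigma> \<in> carrier G \<Longrightarrow> 0 \<in> \<Delta> \<sigma>"
  using D.part_zero by simp

lemma D_add: "\<sigma> \<in> carrier G \<Longrightarrow> x \<in> \<Delta> \<sigma> \<Longrightarrow> y \<in> \<Delta> \<sigma> \<Longrightarrow> x + y \<in> \<Delta> \<sigma>"
  using D.part_add by simp

lemma D_uminus:
  assumes "\<sigma> \<in> carrier G" "x \<in> \<Delta> \<sigma>"
  shows "- x \<in> \<Delta> \<sigma>"
proof -
  have "\<ominus>\<^bsub>class_ring\<^esub> x = - x" by (rule abelian_group.minus_equality[OF graded_group.axioms(1)[OF D.graded_group_axioms]]) auto
  then show ?thesis using D.part_uminus[OF assms] by simp
qed

lemma D_sum: "\<sigma> \<in> carrier G \<Longrightarrow> (\<And>j. j \<in> J \<Longrightarrow> f j \<in> \<Delta> \<sigma>) \<Longrightarrow> sum f J \<in> \<Delta> \<sigma>"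
  by (induction J rule: infinite_finite_induct) (auto simp: D_zero D_add)

lemma D_mult: "\<lbrakk>\<sigma> \<in> carrier G; \<tau> \<in> carrier G; x \<in> \<Delta> \<sigma>; y \<in> \<Delta> \<tau>\<rbrakk> \<Longrightarrow> x * y \<in> \<Delta> (\<sigma> \<otimes> \<tau>)"
  using graded_division by (simp add: graded_division_ring_def graded_ring_def)

text \<open>\<open>graded_ring\<close> does not postulate the degree of 1. Let \<open>u\<close> be
  its component of degree \<open>\<one>\<close>. For homogeneous \<open>x\<close>, comparing
  components in the degree of \<open>x\<close> in 1 * x = x gives u * x = x. Hence \<open>u\<close>
  is a left identity and equals 1.\<close>

lemma D_one: "1 \<in> \<Delta> \<one>"
proof -
  define u where "u = D.comp 1 \<one>"
  have "x = u * x" for x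
  proof -
    have "x \<in> carrier class_ring" by simp
    then show ?thesis
    proof (induction x rule: D.graded_induct)
      case (homog \<tau> x)
      \<comment> \<open>Right multiplication by \<open>x\<close> is additive and translates degrees
        by \<tau>.\<close>
      have "D.comp (1 * x) (\<one> \<otimes> \<tau>) = D.comp 1 \<one> * x"
        by (rule comp_additive_map[of _ _ _ _ _ "\<lambda>y. y * x" "\<lambda>\<sigma>. \<sigma> \<otimes> \<tau>"])
          (use homog in \<open>auto simp: D.graded_group_axioms distrib_right D_mult inj_on_def\<close>)
      then show ?case using homog D.comp_part[of \<tau> x \<tau>] by (simp add: u_def)
    qed (auto simp: distrib_left)
  qed
  from this[of 1] show ?thesis using D.comp_spec(1)[of 1 \<one>] by (simp add: u_def)
qed

text \<open>The division hypothesis gives an inverse \<open>e\<close> of no prescribed degree.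
  Taking components of degree \<open>\<one>\<close> in d * e = 1 shows that the component of
  \<open>e\<close> in degree \<open>inv \<sigma>\<close> is a right inverse too, hence equal to
  \<open>e\<close>.\<close>

lemma D_inverse:
  assumes "\<sigma> \<in> carrier G" "d \<in> \<Delta> \<sigma>" "d \<noteq> 0"
  shows "\<exists>e\<in>\<Delta> (inv \<sigma>). e * d = 1 \<and> d * e = 1"
proof -
  have "d \<in> Units (class_ring :: 'd ring)"
    using graded_division assms by (simp add: graded_division_ring_def)
  then obtain e where e: "e * d = 1" "d * e = 1" by (auto simp: Units_def)
  have "D.comp (d * e) (\<sigma> \<otimes> inv \<sigma>) = d * D.comp e (inv \<sigma>)"
    by (rule comp_additive_map[of _ _ _ _ _ "\<lambda>y. d * y" "\<lambda>\<tau>. \<sigma> \<otimes> \<tau>"])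
      (use assms in \<open>auto simp: D.graded_group_axioms distrib_left D_mult inj_on_def\<close>)
  then have "d * D.comp e (inv \<sigma>) = 1"
    using D.comp_part[OF one_closed D_one, of \<one>] e(2) assms by simp
  then have "D.comp e (inv \<sigma>) = e" using e(1) by (metis mult.assoc mult_1_left mult_1_right)
  moreover have "D.comp e (inv \<sigma>) \<in> \<Delta> (inv \<sigma>)" using D.comp_spec(1)[of e] assms by simp
  ultimately show ?thesis using e by auto
qed

abbreviation H where "H \<equiv> gr_supp G (class_ring :: 'd ring) \<Delta>"

lemma supp_iff: "\<sigma> \<in> carrier G \<Longrightarrow> \<sigma> \<in> H \<longleftrightarrow> (\<exists>d\<in>\<Delta> \<sigma>. d \<noteq> 0)"
  unfolding gr_supp_def using D_zero by auto

lemma supp_carrier: "\<sigma> \<in> H \<Longrightarrow> \<sigma> \<in> carrier G"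
  by (simp add: gr_supp_def)

text \<open>A product of nonzero homogeneous elements is nonzero because the left factor is
  invertible.\<close>

lemma subgroup_supp: "subgroup H G"
proof (rule subgroupI)
  show "H \<subseteq> carrier G" using supp_carrier by blast
  show "H \<noteq> {}" using supp_iff[OF one_closed] D_one nontriv by blast
next
  fix \<sigma> assume \<sigma>: "\<sigma> \<in> H"
  then obtain d where d: "d \<in> \<Delta> \<sigma>" "d \<noteq> 0" using supp_iff supp_carrier by blast
  obtain e where "e \<in> \<Delta> (inv \<sigma>)" "e * d = 1" using D_inverse[OF supp_carrier[OF \<sigma>] d] by blast
  moreover from this have "e \<noteq> 0" using nontriv by auto
  ultimately show "inv \<sigma> \<in> H" using supp_iff[of "inv \<sigma>"] supp_carrier[OF \<sigma>] by auto
  fix \<tau> assume \<tau>: "\<tau> \<in> H"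
  then obtain d' where d': "d' \<in> \<Delta> \<tau>" "d' \<noteq> 0" using supp_iff supp_carrier by blast
  have "e * (d * d') = d'" using \<open>e * d = 1\<close> by (simp flip: mult.assoc)
  then have "d * d' \<noteq> 0" using d' by auto
  moreover have "d * d' \<in> \<Delta> (\<sigma> \<otimes> \<tau>)" using d d' \<sigma> \<tau> supp_carrier by (intro D_mult) auto
  ultimately show "\<sigma> \<otimes> \<tau> \<in> H" using supp_iff[of "\<sigma> \<otimes> \<tau>"] \<sigma> \<tau> supp_carrier by auto
qed

lemma card_independent_le_spanning_D:
  fixes s :: "'k \<Rightarrow> 'l \<Rightarrow> 'd" and r :: "'j \<Rightarrow> 'l \<Rightarrow> 'd"
  assumes "finite J" "finite K"
    and "\<And>k. k \<in> K \<Longrightarrow> \<exists>c. (\<forall>j\<in>J. c j \<in> \<Delta> \<one>) \<and> (\<forall>l\<in>L. s k l = (\<Sum>j\<in>J. c j * r j l))"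
    and "\<And>x k. (\<And>k. k \<in> K \<Longrightarrow> x k \<in> \<Delta> \<one>) \<Longrightarrow> (\<And>l. l \<in> L \<Longrightarrow> (\<Sum>k\<in>K. x k * s k l) = 0) \<Longrightarrow>
      k \<in> K \<Longrightarrow> x k = 0"
  shows "card K \<le> card J"
proof (rule card_independent_le_spanning[where D = "\<Delta> \<one>" and J = J and K = K and s = s and r = r and L = L])
  show "\<And>x y. x \<in> \<Delta> \<one> \<Longrightarrow> y \<in> \<Delta> \<one> \<Longrightarrow> x * y \<in> \<Delta> \<one>"
    using D_mult[of \<one> \<one>] by simp
  show "\<And>x. x \<in> \<Delta> \<one> \<Longrightarrow> x \<noteq> 0 \<Longrightarrow> \<exists>y\<in>\<Delta> \<one>. y * x = 1"
    using D_inverse[of \<one>] by fastforce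
qed (use assms in \<open>simp_all add: nontriv D_zero D_one D_add D_uminus\<close>)

end


section \<open>Graded matrix rings and their column modules\<close>

text \<open>Rectangular shapes are allowed because the 1 by n and n by 1 units convert between
  columns and square matrices.\<close>

definition unit_mat :: "nat \<Rightarrow> nat \<Rightarrow> nat \<Rightarrow> nat \<Rightarrow> 'd::zero \<Rightarrow> 'd mat" where
  "unit_mat p q i j d = mat p q (\<lambda>(r, s). if r = i \<and> s = j then d else 0)"

lemma unit_mat_carrier [simp]: "unit_mat p q i j d \<in> carrier_mat p q"
  by (simp add: unit_mat_def)

lemma unit_mat_dim [simp]: "dim_row (unit_mat p q i j d) = p" "dim_col (unit_mat p q i j d) = q"
  by (simp_all add: unit_mat_def)

lemma unit_mat_index [simp]:
  "r < p \<Longrightarrow> s < q \<Longrightarrow> unit_mat p q i j d $$ (r, s) = (if r = i \<and> s = j then d else 0)"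
  by (simp add: unit_mat_def)

lemma index_mult_mat_sum:
  assumes "a \<in> carrier_mat m p" "b \<in> carrier_mat p q" "i < m" "l < q"
  shows "(a * b) $$ (i, l) = (\<Sum>j<p. a $$ (i, j) * b $$ (j, l))"
  using assms by (auto simp: scalar_prod_def atLeast0LessThan intro!: sum.cong)

lemma unit_mat_mult_index:
  fixes d :: "'d::semiring_1"
  assumes "b \<in> carrier_mat q l" "r < p" "s < l" "j < q"
  shows "(unit_mat p q i j d * b) $$ (r, s) = (if r = i then d * b $$ (j, s) else 0)"
proof -
  have "(unit_mat p q i j d * b) $$ (r, s) = (\<Sum>k<q. unit_mat p q i j d $$ (r, k) * b $$ (k, s))"
    by (rule index_mult_mat_sum) (use assms in auto)
  also have "\<dots> = (\<Sum>k<q. if k = j then (if r = i then d * b $$ (j, s) else 0) else 0)"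
    using assms by (intro sum.cong) auto
  finally show ?thesis using assms by simp
qed

lemma mult_unit_mat_index:
  fixes d :: "'d::semiring_1"
  assumes "a \<in> carrier_mat l p" "r < l" "s < q" "i < p"
  shows "(a * unit_mat p q i j d) $$ (r, s) = (if s = j then a $$ (r, i) * d else 0)"
proof -
  have "(a * unit_mat p q i j d) $$ (r, s) = (\<Sum>k<p. a $$ (r, k) * unit_mat p q i j d $$ (k, s))"
    by (rule index_mult_mat_sum) (use assms in auto)
  also have "\<dots> = (\<Sum>k<p. if k = i then (if s = j then a $$ (r, i) * d else 0) else 0)"
    using assms by (intro sum.cong) auto
  finally show ?thesis using assms by simp
qed

lemma unit_mat_mult_unit_mat:
  fixes d e :: "'d::semiring_1"
  assumes "j < q"
  shows "unit_mat p q i j d * unit_mat q l j k e = unit_mat p l i k (d * e)"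
  by (rule eq_matI) (use assms in \<open>auto simp: unit_mat_mult_index[of _ q l] simp del: index_mult_mat(1)\<close>)

locale graded_matrix_ring = graded_division G \<Delta> for G (structure) and \<Delta> :: "'a \<Rightarrow> 'd::ring_1 set" +
  fixes n :: nat and g :: "nat \<Rightarrow> 'a"
  assumes n_pos: "n > 0" and g_carrier [simp]: "i < n \<Longrightarrow> g i \<in> carrier G"
begin

abbreviation A where "A \<equiv> ring_mat TYPE('d) n ()"
abbreviation P where "P \<equiv> matrix_grading G \<Delta> n g"

text \<open>For \<open>p = n\<close> and \<open>h = g\<close> this is the regular module, and for \<open>p = 1\<close> the column module
  \<open>V h\<close>; treating both at once makes every homomorphism between them a right multiplication.\<close>

definition mat_module :: "nat \<Rightarrow> (nat \<Rightarrow> 'a) \<Rightarrow> ('d mat, 'd mat, 'a) gr_module" where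
  "mat_module p h =
     \<lparr>carrier = carrier_mat n p, mult = (*), one = 1\<^sub>m p, zero = 0\<^sub>m n p, add = (+), smult = (*),
      gr_part = (\<lambda>\<sigma>. {a \<in> carrier_mat n p.
        \<forall>i<n. \<forall>j<p. a $$ (i, j) \<in> \<Delta> (g i \<otimes> \<sigma> \<otimes> inv (h j))})\<rparr>"

abbreviation V where "V h \<equiv> mat_module 1 (\<lambda>_. h)"

lemma mat_module_simps [simp]:
  "carrier (mat_module p h) = carrier_mat n p" "zero (mat_module p h) = 0\<^sub>m n p"
  "add (mat_module p h) = (+)" "smult (mat_module p h) = (*)"
  by (simp_all add: mat_module_def)

lemma in_part_iff:
  "a \<in> gr_part (mat_module p h) \<sigma> \<longleftrightarrow>
    a \<in> carrier_mat n p \<and> (\<forall>i<n. \<forall>j<p. a $$ (i, j) \<in> \<Delta> (g i \<otimes> \<sigma> \<otimes> inv (h j)))"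
  by (simp add: mat_module_def)

lemma regular_eq: "regular_gr_module A P = mat_module n g"
  unfolding regular_gr_module_def mat_module_def ring_mat_def matrix_grading_def by simp

lemma P_eq: "P = gr_part (mat_module n g)"
  unfolding mat_module_def matrix_grading_def by simp

lemma cancel_inv [simp]:
  "x \<in> carrier G \<Longrightarrow> y \<in> carrier G \<Longrightarrow> inv x \<otimes> (x \<otimes> y) = y"
  "x \<in> carrier G \<Longrightarrow> y \<in> carrier G \<Longrightarrow> x \<otimes> (inv x \<otimes> y) = y"
  by (simp_all flip: m_assoc)

lemma abelian_group_mat_module: "abelian_group (mat_module p h)"
proof (rule abelian_groupI)
  fix x assume "x \<in> carrier (mat_module p h)"
  then show "\<exists>y\<in>carrier (mat_module p h). y \<oplus>\<^bsub>mat_module p h\<^esub> x = \<zero>\<^bsub>mat_module p h\<^esub>"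
    by (intro bexI[of _ "- x"]) auto
qed auto

lemma ring_A: "ring A"
proof (rule ringI)
  show "abelian_group A"
  proof (rule abelian_groupI)
    fix x assume "x \<in> carrier A"
    then show "\<exists>y\<in>carrier A. y \<oplus>\<^bsub>A\<^esub> x = \<zero>\<^bsub>A\<^esub>"
      by (intro bexI[of _ "- x"]) (auto simp: ring_mat_simps)
  qed (auto simp: ring_mat_simps)
  show "monoid A" by (rule monoidI) (auto simp: ring_mat_simps)
qed (auto simp: ring_mat_simps add_mult_distrib_mat mult_add_distrib_mat)

text \<open>Degrees telescope: the product of \<open>u i \<otimes> inv (v j)\<close> and
  \<open>v j \<otimes> w l\<close> does not depend on the summation index \<open>j\<close>. The
  labels are kept general to serve both the module action and right multiplications.\<close>

lemma mult_homogeneous: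
  assumes "a \<in> carrier_mat m p" "b \<in> carrier_mat p q"
    and "\<And>i. i < m \<Longrightarrow> u i \<in> carrier G" "\<And>j. j < p \<Longrightarrow> v j \<in> carrier G"
      "\<And>l. l < q \<Longrightarrow> w l \<in> carrier G"
    and "\<And>i j. i < m \<Longrightarrow> j < p \<Longrightarrow> a $$ (i, j) \<in> \<Delta> (u i \<otimes> inv (v j))"
    and "\<And>j l. j < p \<Longrightarrow> l < q \<Longrightarrow> b $$ (j, l) \<in> \<Delta> (v j \<otimes> w l)"
    and "i < m" "l < q"
  shows "(a * b) $$ (i, l) \<in> \<Delta> (u i \<otimes> w l)"
proof -
  have "(\<Sum>j<p. a $$ (i, j) * b $$ (j, l)) \<in> \<Delta> (u i \<otimes> w l)"
  proof (rule D_sum)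
    fix j assume "j \<in> {..<p}"
    then have "a $$ (i, j) * b $$ (j, l) \<in> \<Delta> ((u i \<otimes> inv (v j)) \<otimes> (v j \<otimes> w l))"
      using assms by (intro D_mult) auto
    then show "a $$ (i, j) * b $$ (j, l) \<in> \<Delta> (u i \<otimes> w l)"
      using assms \<open>j \<in> {..<p}\<close> by (simp add: m_assoc)
  qed (use assms in auto)
  then show ?thesis using assms by (simp add: index_mult_mat_sum del: index_mult_mat)
qed

lemma mat_module_grading:
  assumes h: "\<And>j. j < p \<Longrightarrow> h j \<in> carrier G"
  shows "is_grading G (mat_module p h) (gr_part (mat_module p h))"
proof -
  interpret M: abelian_group "mat_module p h" by (rule abelian_group_mat_module)
  \<comment> \<open>Homogeneous parts are taken entrywise; the labels of the row and the column
    translate the degree, injectively in \<sigma>.\<close>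
  define \<pi> where "\<pi> = (\<lambda>a \<sigma>. mat n p (\<lambda>(i, j). D.comp (a $$ (i, j)) (g i \<otimes> \<sigma> \<otimes> inv (h j))))"
  have \<pi>_index: "\<pi> a \<sigma> $$ (i, j) = D.comp (a $$ (i, j)) (g i \<otimes> \<sigma> \<otimes> inv (h j))"
    if "i < n" "j < p" for a \<sigma> i j using that by (simp add: \<pi>_def)
  have \<pi>_carrier [simp]: "\<pi> a \<sigma> \<in> carrier_mat n p" "dim_row (\<pi> a \<sigma>) = n" "dim_col (\<pi> a \<sigma>) = p" for a \<sigma>
    by (simp_all add: \<pi>_def)
  show ?thesis
  proof (rule is_gradingI[where \<pi> = \<pi>])
    show "abelian_group (mat_module p h)" by (rule abelian_group_mat_module)
  next
    fix \<sigma> assume \<sigma>: "\<sigma> \<in> carrier G"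
    show "additive_subgroup (gr_part (mat_module p h) \<sigma>) (mat_module p h)"
    proof (intro additive_subgroupI group.subgroupI)
      show "group (add_monoid (mat_module p h))" by (rule M.a_group)
      have "0\<^sub>m n p \<in> gr_part (mat_module p h) \<sigma>" using \<sigma> h by (auto simp: in_part_iff D_zero)
      then show "gr_part (mat_module p h) \<sigma> \<noteq> {}" by blast
    next
      fix a assume a: "a \<in> gr_part (mat_module p h) \<sigma>"
      then have "\<ominus>\<^bsub>mat_module p h\<^esub> a = - a"
        by (intro M.minus_equality) (auto simp: in_part_iff)
      then show "inv\<^bsub>add_monoid (mat_module p h)\<^esub> a \<in> gr_part (mat_module p h) \<sigma>"
        using a \<sigma> h by (auto simp: in_part_iff a_inv_def D_uminus)
    next
      fix a b assume "a \<in> gr_part (mat_module p h) \<sigma>" "b \<in> gr_part (mat_module p h) \<sigma>"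
      then show "a \<otimes>\<^bsub>add_monoid (mat_module p h)\<^esub> b \<in> gr_part (mat_module p h) \<sigma>"
        using \<sigma> h by (auto simp: in_part_iff D_add)
    qed (auto simp: in_part_iff)
  next
    fix a \<sigma> assume "a \<in> carrier (mat_module p h)" "\<sigma> \<in> carrier G"
    then show "\<pi> a \<sigma> \<in> gr_part (mat_module p h) \<sigma>"
      using h by (auto simp: in_part_iff \<pi>_index D.comp_spec)
  next
    fix a b \<sigma> assume "a \<in> carrier (mat_module p h)" "b \<in> carrier (mat_module p h)" "\<sigma> \<in> carrier G"
    then show "\<pi> (a \<oplus>\<^bsub>mat_module p h\<^esub> b) \<sigma> = \<pi> a \<sigma> \<oplus>\<^bsub>mat_module p h\<^esub> \<pi> b \<sigma>"
      using D.comp_add by (auto intro!: eq_matI simp: \<pi>_index)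
  next
    fix a \<sigma> \<rho> assume *: "\<sigma> \<in> carrier G" "\<rho> \<in> carrier G" "a \<in> gr_part (mat_module p h) \<sigma>"
    have "\<pi> a \<rho> $$ (i, j) = (if \<rho> = \<sigma> then a $$ (i, j) else 0)" if "i < n" "j < p" for i j
    proof -
      have "a $$ (i, j) \<in> \<Delta> (g i \<otimes> \<sigma> \<otimes> inv (h j))" using * that by (auto simp: in_part_iff)
      moreover have "g i \<otimes> \<rho> \<otimes> inv (h j) = g i \<otimes> \<sigma> \<otimes> inv (h j) \<longleftrightarrow> \<rho> = \<sigma>"
        using * that h by simp
      ultimately show ?thesis
        using D.comp_part[of "g i \<otimes> \<sigma> \<otimes> inv (h j)" "a $$ (i, j)"] * that h by (simp add: \<pi>_index)
    qed
    then show "\<pi> a \<rho> = (if \<rho> = \<sigma> then a else \<zero>\<^bsub>mat_module p h\<^esub>)"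
      using * by (auto intro!: eq_matI simp: in_part_iff)
  next
    fix a assume a: "a \<in> carrier (mat_module p h)"
    \<comment> \<open>Each of the finitely many entries has finitely many nonzero components, and a
      component of degree tau at (i, j) is seen only by sigma = g_i^-1 tau h_j.\<close>
    have "{\<sigma> \<in> carrier G. \<pi> a \<sigma> \<noteq> 0\<^sub>m n p} \<subseteq>
      (\<Union>i<n. \<Union>j<p. (\<lambda>\<tau>. inv (g i) \<otimes> \<tau> \<otimes> h j) ` {\<tau>. D.comp (a $$ (i, j)) \<tau> \<noteq> 0})"
    proof
      fix \<sigma> assume "\<sigma> \<in> {\<sigma> \<in> carrier G. \<pi> a \<sigma> \<noteq> 0\<^sub>m n p}"
      then have \<sigma>: "\<sigma> \<in> carrier G" "\<pi> a \<sigma> \<noteq> 0\<^sub>m n p" by auto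
      then obtain i j where ij: "i < n" "j < p" "\<pi> a \<sigma> $$ (i, j) \<noteq> 0"
        using eq_matI[of "0\<^sub>m n p" "\<pi> a \<sigma>"] by fastforce
      then have "\<sigma> = inv (g i) \<otimes> (g i \<otimes> \<sigma> \<otimes> inv (h j)) \<otimes> h j"
        using \<sigma> h by (simp add: m_assoc)
      then show "\<sigma> \<in> (\<Union>i<n. \<Union>j<p. (\<lambda>\<tau>. inv (g i) \<otimes> \<tau> \<otimes> h j) ` {\<tau>. D.comp (a $$ (i, j)) \<tau> \<noteq> 0})"
        using ij \<pi>_index[OF ij(1,2)] by auto
    qed
    then show "finite {\<sigma> \<in> carrier G. \<pi> a \<sigma> \<noteq> \<zero>\<^bsub>mat_module p h\<^esub>}"
      using D.comp_spec(3) by (auto intro: finite_subset)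
    assume \<pi>0: "\<And>\<sigma>. \<sigma> \<in> carrier G \<Longrightarrow> \<pi> a \<sigma> = \<zero>\<^bsub>mat_module p h\<^esub>"
    have "a $$ (i, j) = 0" if ij: "i < n" "j < p" for i j
    proof -
      have "D.comp (a $$ (i, j)) \<tau> = 0" if \<tau>: "\<tau> \<in> carrier G" for \<tau>
      proof -
        have "\<pi> a (inv (g i) \<otimes> \<tau> \<otimes> h j) $$ (i, j) = 0" using \<pi>0 ij h \<tau> by simp
        then show ?thesis using ij h \<tau> by (simp add: \<pi>_index m_assoc)
      qed
      then show ?thesis using D.comp_separates[of "a $$ (i, j)"] by simp
    qed
    then show "a = \<zero>\<^bsub>mat_module p h\<^esub>" using a by (auto intro!: eq_matI)
  qed
qed

lemma mat_module_graded:
  assumes "\<And>j. j < p \<Longrightarrow> h j \<in> carrier G"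
  shows "graded_left_module G A P (mat_module p h)"
proof -
  interpret A: ring A by (rule ring_A)
  interpret M: abelian_group "mat_module p h" by (rule abelian_group_mat_module)
  show ?thesis
  proof unfold_locales
    show "is_grading G (mat_module p h) (gr_part (mat_module p h))"
      using assms by (rule mat_module_grading)
    fix \<sigma> \<tau> a x
    assume *: "\<sigma> \<in> carrier G" "\<tau> \<in> carrier G" "a \<in> P \<sigma>" "x \<in> gr_part (mat_module p h) \<tau>"
    have "(a * x) $$ (i, l) \<in> \<Delta> ((g i \<otimes> \<sigma>) \<otimes> (\<tau> \<otimes> inv (h l)))" if "i < n" "l < p" for i l
      by (rule mult_homogeneous[of _ n n _ p _ g])
        (use * that assms in \<open>auto simp: P_eq in_part_iff m_assoc\<close>)
    then have "(a * x) $$ (i, l) \<in> \<Delta> (g i \<otimes> (\<sigma> \<otimes> \<tau>) \<otimes> inv (h l))" if "i < n" "l < p" for i l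
      using * that assms by (simp add: m_assoc del: index_mult_mat)
    then show "a \<odot>\<^bsub>mat_module p h\<^esub> x \<in> gr_part (mat_module p h) (\<sigma> \<otimes> \<tau>)"
      using * by (auto simp: in_part_iff P_eq simp del: index_mult_mat(1))
  qed (auto simp: ring_mat_simps add_mult_distrib_mat mult_add_distrib_mat)
qed

lemma V_graded: "h \<in> carrier G \<Longrightarrow> graded_left_module G A P (V h)"
  by (rule mat_module_graded)

lemma A_graded: "graded_left_module G A P (mat_module n g)"
  by (rule mat_module_graded) simp

lemma P_carrier: "\<sigma> \<in> carrier G \<Longrightarrow> P \<sigma> \<subseteq> carrier A"
  by (auto simp: P_eq in_part_iff ring_mat_simps)

lemma right_mult_hom:
  assumes "b \<in> carrier_mat p q" "\<And>j. j < p \<Longrightarrow> h j \<in> carrier G" "\<And>l. l < q \<Longrightarrow> k l \<in> carrier G"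
    and "\<And>j l. j < p \<Longrightarrow> l < q \<Longrightarrow> b $$ (j, l) \<in> \<Delta> (h j \<otimes> inv (k l))"
  shows "(\<lambda>a. a * b) \<in> gr_hom G A (mat_module p h) (mat_module q k)"
proof (rule gr_homI)
  fix \<sigma> a assume *: "\<sigma> \<in> carrier G" "a \<in> gr_part (mat_module p h) \<sigma>"
  have "(a * b) $$ (i, l) \<in> \<Delta> ((g i \<otimes> \<sigma>) \<otimes> inv (k l))" if "i < n" "l < q" for i l
    by (rule mult_homogeneous[of _ n p _ q _ h])
      (use * that assms in \<open>auto simp: in_part_iff\<close>)
  then show "a * b \<in> gr_part (mat_module q k) \<sigma>"
    using * assms by (auto simp: in_part_iff simp del: index_mult_mat(1))
qed (use assms in \<open>auto simp: ring_mat_simps add_mult_distrib_mat\<close>)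

abbreviation \<epsilon> where "\<epsilon> \<equiv> unit_mat n 1 0 0 (1::'d)"
abbreviation E :: "nat \<Rightarrow> nat \<Rightarrow> 'd \<Rightarrow> 'd mat" where "E \<equiv> unit_mat n n"

lemma E_carrier [simp]: "E i j d \<in> carrier A"
  by (simp add: ring_mat_simps)

lemma E_homogeneous:
  assumes "i < n" "j < n" "\<sigma> \<in> carrier G" "d \<in> \<Delta> (g i \<otimes> \<sigma> \<otimes> inv (g j))"
  shows "E i j d \<in> P \<sigma>"
  using assms by (auto simp: P_eq in_part_iff D_zero)

lemma \<epsilon>_part: "h \<in> carrier G \<Longrightarrow> \<epsilon> \<in> gr_part (V h) (inv (g 0) \<otimes> h)"
  using n_pos by (auto simp: in_part_iff D_zero D_one m_assoc)

text \<open>The row unit times \<epsilon> is the 1 by 1 identity. Thus \<epsilon> generates every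
  \<open>V h\<close>, and multiplication by \<epsilon> undoes the embedding of columns as first
  columns of square matrices.\<close>

lemma \<epsilon>_generates: "v \<in> carrier_mat n 1 \<Longrightarrow> (v * unit_mat 1 n 0 0 1) * \<epsilon> = v"
  using n_pos unit_mat_mult_unit_mat[of 0 n 1 0 1 1 0 "1::'d"]
  by (subst assoc_mult_mat[of _ n 1 _ n _ 1]) (auto intro!: eq_matI simp: mult_unit_mat_index simp del: index_mult_mat(1))


section \<open>Classification of the graded simple modules\<close>

declare One_nat_def [simp del]

text \<open>Every entry of a homogeneous column is homogeneous in \<Delta>, so a nonzero entry is
  invertible.\<close>

lemma V_homogeneous_unit:
  assumes "h \<in> carrier G" "\<sigma> \<in> carrier G" "v \<in> gr_part (V h) \<sigma>" "v \<noteq> 0\<^sub>m n 1"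
  obtains k e where "k < n" "e * v $$ (k, 0) = 1"
proof -
  obtain k where k: "k < n" "v $$ (k, 0) \<noteq> 0"
    using assms(3,4) eq_matI[of "0\<^sub>m n 1" v] by (fastforce simp: in_part_iff)
  moreover have "v $$ (k, 0) \<in> \<Delta> (g k \<otimes> \<sigma> \<otimes> inv h)" using assms(3) k by (simp add: in_part_iff)
  ultimately show ?thesis using D_inverse[of "g k \<otimes> \<sigma> \<otimes> inv h" "v $$ (k, 0)"] assms that by auto
qed

text \<open>A nonzero homogeneous kernel element \<open>v\<close> has an entry with a left inverse
  \<open>e\<close>, say in row \<open>k\<close>; then \<open>E 0 k e\<close> carries
  \<open>v\<close> to \<epsilon>, and \<open>f \<epsilon>\<close> would vanish.\<close>

lemma hom_V_inj:
  assumes "h \<in> carrier G" "graded_left_module G A P M" "f \<in> gr_hom G A (V h) M" "f \<epsilon> \<noteq> \<zero>\<^bsub>M\<^esub>"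
  shows "inj_on f (carrier (V h))"
proof (rule gr_hom_inj[OF V_graded[OF assms(1)] assms(2,3)])
  interpret M: graded_left_module G A P M by fact
  fix \<sigma> v assume v: "\<sigma> \<in> carrier G" "v \<in> gr_part (V h) \<sigma>" "f v = \<zero>\<^bsub>M\<^esub>"
  show "v = \<zero>\<^bsub>V h\<^esub>"
  proof (rule ccontr)
    assume "v \<noteq> \<zero>\<^bsub>V h\<^esub>"
    then obtain k e where k: "k < n" "e * v $$ (k, 0) = 1"
      using V_homogeneous_unit[OF assms(1) v(1,2)] by auto
    have car: "v \<in> carrier_mat n 1" using v by (simp add: in_part_iff)
    have "E 0 k e * v = \<epsilon>"
      using k car by (auto intro!: eq_matI simp: unit_mat_mult_index[of _ n 1] simp del: index_mult_mat(1))
    then have "f \<epsilon> = E 0 k e \<odot>\<^bsub>M\<^esub> f v"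
      using gr_homD(3)[OF assms(3) E_carrier[of 0 k e], of v] car by simp
    then show False using assms(4) v(3) M.smult_zero_right[OF E_carrier] by simp
  qed
qed

text \<open>Nonzero homogeneous elements generate: if \<open>e\<close> is a left inverse of entry
  \<open>k\<close> of \<open>v\<close>, the row with \<open>e\<close> at position \<open>k\<close>
  sends \<open>v\<close> to the 1 by 1 identity, so \<open>w\<close> times this row is a matrix
  sending \<open>v\<close> to the prescribed column \<open>w\<close>.\<close>

lemma hom_V_onto_simple:
  assumes "h \<in> carrier G" "graded_left_module G A P M" "f \<in> gr_hom G A (V h) M" "f \<epsilon> \<noteq> \<zero>\<^bsub>M\<^esub>"
    and onto: "f ` carrier (V h) = carrier M"
  shows "gr_simple G A P M"
proof -
  interpret M: graded_left_module G A P M by fact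
  note inj = hom_V_inj[OF assms(1-4)]
  show ?thesis
  proof (rule M.gr_simpleI)
    have "f \<epsilon> \<in> carrier M" using gr_homD(1)[OF assms(3)] by simp
    then show "carrier M \<noteq> {\<zero>\<^bsub>M\<^esub>}" using assms(4) by blast
    fix \<sigma> x y
    assume x: "\<sigma> \<in> carrier G" "x \<in> gr_part M \<sigma>" "x \<noteq> \<zero>\<^bsub>M\<^esub>" and y: "y \<in> carrier M"
    have "x \<in> carrier M" using x M.part_carrier by blast
    then obtain v w where v: "v \<in> carrier_mat n 1" "x = f v" and w: "w \<in> carrier_mat n 1" "y = f w"
      using onto y unfolding mat_module_simps by blast
    have "v \<in> gr_part (V h) \<sigma>"
      using gr_hom_part_preimage[OF V_graded[OF assms(1)] assms(2,3) inj _ x(1)] x v by simp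
    moreover have "v \<noteq> 0\<^sub>m n 1"
      using x(3) v(2) gr_hom_zero[OF V_graded[OF assms(1)] assms(2,3)] by auto
    ultimately obtain k e where k: "k < n" "e * v $$ (k, 0) = 1"
      using V_homogeneous_unit[OF assms(1) x(1)] by blast
    have "(w * unit_mat 1 n 0 k e) * v = w * (unit_mat 1 n 0 k e * v)"
      using w v by (intro assoc_mult_mat) auto
    also have "unit_mat 1 n 0 k e * v = 1\<^sub>m 1"
      using k v by (auto intro!: eq_matI simp: unit_mat_mult_index[of _ n 1] simp del: index_mult_mat(1))
    finally have "y = f ((w * unit_mat 1 n 0 k e) * v)" using w by simp
    moreover have "w * unit_mat 1 n 0 k e \<in> carrier A"
      using w by (simp add: ring_mat_simps)
    ultimately show "\<exists>a\<in>carrier A. y = a \<odot>\<^bsub>M\<^esub> x"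
      using gr_homD(3)[OF assms(3), of _ v] v by auto
  qed
qed

lemma \<epsilon>_nonzero: "\<epsilon> \<noteq> 0\<^sub>m n 1"
proof
  assume "\<epsilon> = 0\<^sub>m n 1"
  then have "\<epsilon> $$ (0, 0) = 0" using n_pos by simp
  then show False using n_pos nontriv by simp
qed

lemma hom_V_\<epsilon>_nonzero:
  assumes "h \<in> carrier G" "graded_left_module G A P M" "f \<in> gr_hom G A (V h) M"
    and "inj_on f (carrier (V h))"
  shows "f \<epsilon> \<noteq> \<zero>\<^bsub>M\<^esub>"
proof
  assume "f \<epsilon> = \<zero>\<^bsub>M\<^esub>"
  then have "f \<epsilon> = f (0\<^sub>m n 1)" using gr_hom_zero[OF V_graded[OF assms(1)] assms(2,3)] by simp
  then show False using assms(4) \<epsilon>_nonzero by (auto dest: inj_onD)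
qed

lemma simple_of_iso_V:
  assumes "h \<in> carrier G" "graded_left_module G A P M" "gr_iso G A (V h) M"
  shows "gr_simple G A P M"
proof -
  obtain f where f: "f \<in> gr_hom G A (V h) M" "bij_betw f (carrier (V h)) (carrier M)"
    using assms(3) unfolding gr_iso_def by blast
  then show ?thesis
    using hom_V_onto_simple[OF assms(1,2) f(1)] hom_V_\<epsilon>_nonzero[OF assms(1,2) f(1)]
    by (simp add: bij_betw_def)
qed

text \<open>Homomorphisms out of \<open>V h\<close> are the elements of degree \<open>inv (g 0) \<otimes> h\<close> fixed by the idempotent
  \<open>E 0 0 1\<close>, the correspondence being evaluation at \<open>\<epsilon>\<close>.\<close>

lemma hom_V_of_element:
  assumes "\<tau> \<in> carrier G" "graded_left_module G A P M" "x \<in> gr_part M \<tau>" "E 0 0 1 \<odot>\<^bsub>M\<^esub> x = x"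
  obtains f where "f \<in> gr_hom G A (V (g 0 \<otimes> \<tau>)) M" "f \<epsilon> = x"
proof
  interpret M: graded_left_module G A P M by fact
  have x: "x \<in> carrier M" using assms M.part_carrier by blast
  let ?u = "unit_mat 1 n 0 0 (1::'d)"
  \<comment> \<open>The only possible choice: \<open>v * ?u\<close> is the square matrix with first
    column \<open>v\<close>, and it sends \<epsilon> to \<open>v\<close>.\<close>
  let ?f = "\<lambda>v. (v * ?u) \<odot>\<^bsub>M\<^esub> x"
  have car: "v * ?u \<in> carrier A" if "v \<in> carrier_mat n 1" for v
    using that by (simp add: ring_mat_simps)
  have "\<epsilon> * ?u = E 0 0 1" using unit_mat_mult_unit_mat[of 0 1 n 0 1 n 0 "1::'d"] by simp
  then show "?f \<epsilon> = x" using assms(4) by simp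
  show "?f \<in> gr_hom G A (V (g 0 \<otimes> \<tau>)) M"
  proof (rule gr_homI)
    fix v assume "v \<in> carrier (V (g 0 \<otimes> \<tau>))"
    then show "?f v \<in> carrier M" using car x M.smult_closed by simp
  next
    fix v w assume "v \<in> carrier (V (g 0 \<otimes> \<tau>))" "w \<in> carrier (V (g 0 \<otimes> \<tau>))"
    then have v: "v \<in> carrier_mat n 1" and w: "w \<in> carrier_mat n 1" by auto
    have "(v + w) * ?u = v * ?u \<oplus>\<^bsub>A\<^esub> w * ?u"
      using add_mult_distrib_mat[OF v w unit_mat_carrier] by (simp add: ring_mat_simps)
    then show "?f (v \<oplus>\<^bsub>V (g 0 \<otimes> \<tau>)\<^esub> w) = ?f v \<oplus>\<^bsub>M\<^esub> ?f w"
      using M.smult_l_distr[OF car[OF v] car[OF w] x] by simp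
  next
    fix a v assume a: "a \<in> carrier A" and "v \<in> carrier (V (g 0 \<otimes> \<tau>))"
    then have v: "v \<in> carrier_mat n 1" by simp
    have "(a * v) * ?u = a \<otimes>\<^bsub>A\<^esub> (v * ?u)"
      using a assoc_mult_mat[OF _ v unit_mat_carrier] by (simp add: ring_mat_simps)
    then show "?f (a \<odot>\<^bsub>V (g 0 \<otimes> \<tau>)\<^esub> v) = a \<odot>\<^bsub>M\<^esub> ?f v"
      using M.smult_assoc[OF a car[OF v] x] by simp
  next
    fix \<sigma> v assume \<sigma>: "\<sigma> \<in> carrier G" and v: "v \<in> gr_part (V (g 0 \<otimes> \<tau>)) \<sigma>"
    \<comment> \<open>The entries of \<open>v\<close> have degrees g_i sigma (g_0 tau)^-1 = g_i
      (sigma tau^-1) g_0^-1, which is what the first column of a matrix of degree sigma tau^-1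
      requires.\<close>
    have "v * ?u \<in> P (\<sigma> \<otimes> inv \<tau>)"
      using v \<sigma> n_pos assms(1)
      by (auto simp: P_eq in_part_iff mult_unit_mat_index[of _ n 1] D_zero m_assoc inv_mult_group
          simp del: index_mult_mat(1))
    then show "?f v \<in> gr_part M \<sigma>"
      using M.smult_graded[of "\<sigma> \<otimes> inv \<tau>" \<tau> "v * ?u" x] assms \<sigma> by (simp add: m_assoc)
  qed
qed

text \<open>Schur's argument: the homomorphism sending \<epsilon> to \<open>x\<close> is injective
  because \<open>x\<close> is nonzero, and onto because its image is a nonzero graded
  submodule.\<close>

lemma simple_iso_V_of_element:
  assumes "\<tau> \<in> carrier G" "gr_simple G A P M" "x \<in> gr_part M \<tau>" "x \<noteq> \<zero>\<^bsub>M\<^esub>" "E 0 0 1 \<odot>\<^bsub>M\<^esub> x = x"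
  shows "gr_iso G A (V (g 0 \<otimes> \<tau>)) M"
proof -
  have M: "graded_left_module G A P M" using assms(2) by (simp add: gr_simple_def)
  obtain f where f: "f \<in> gr_hom G A (V (g 0 \<otimes> \<tau>)) M" "f \<epsilon> = x"
    using hom_V_of_element[OF assms(1) M assms(3,5)] .
  have h: "g 0 \<otimes> \<tau> \<in> carrier G" using assms n_pos by simp
  have "gr_submodule G A M (f ` carrier (V (g 0 \<otimes> \<tau>)))"
    by (rule gr_hom_image[OF V_graded[OF h] M f(1)])
  moreover have "x \<in> f ` carrier (V (g 0 \<otimes> \<tau>))" using f(2) by force
  ultimately have "f ` carrier (V (g 0 \<otimes> \<tau>)) = carrier M"
    using assms(2,4) unfolding gr_simple_def by blast
  then show ?thesis
    unfolding gr_iso_def bij_betw_def using f(1) hom_V_inj[OF h M f(1)] f(2) assms(4) by blast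
qed

text \<open>The diagonal idempotents add up to the identity matrix, so they cannot all kill
  \<open>x\<close>.\<close>

lemma nonzero_diagonal_part:
  assumes "graded_left_module G A P M" "x \<in> carrier M" "x \<noteq> \<zero>\<^bsub>M\<^esub>"
  obtains i where "i < n" "E i i 1 \<odot>\<^bsub>M\<^esub> x \<noteq> \<zero>\<^bsub>M\<^esub>"
proof (rule ccontr)
  interpret M: graded_left_module G A P M by fact
  note witness = that
  assume "\<not> thesis"
  then have E0: "E i i 1 \<odot>\<^bsub>M\<^esub> x = \<zero>\<^bsub>M\<^esub>" if "i < n" for i using witness that by blast
  \<comment> \<open>Partial sums of the diagonal idempotents, from zero at \<open>k = 0\<close> to
    the identity at \<open>k = n\<close>.\<close>
  define I where "I = (\<lambda>k. mat n n (\<lambda>(r, s). if r = s \<and> r < k then 1 else (0::'d)))"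
  have I [simp]: "I k \<in> carrier A" for k by (simp add: I_def ring_mat_simps)
  have "I k \<odot>\<^bsub>M\<^esub> x = \<zero>\<^bsub>M\<^esub>" if "k \<le> n" for k
    using that
  proof (induction k)
    case 0
    have "I 0 = \<zero>\<^bsub>A\<^esub>" by (auto simp: I_def ring_mat_simps)
    then show ?case using M.smult_zero_left[OF assms(2)] by simp
  next
    case (Suc k)
    have "I (Suc k) = I k \<oplus>\<^bsub>A\<^esub> E k k 1"
      by (auto intro!: eq_matI simp: I_def ring_mat_simps)
    then show ?case using Suc E0[of k] M.smult_l_distr[OF I E_carrier assms(2)] by simp
  qed
  moreover have "I n = \<one>\<^bsub>A\<^esub>" by (auto intro!: eq_matI simp: I_def ring_mat_simps)
  ultimately have "\<one>\<^bsub>A\<^esub> \<odot>\<^bsub>M\<^esub> x = \<zero>\<^bsub>M\<^esub>" by (metis order_refl)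
  then show False using M.smult_one[OF assms(2)] assms(3) by simp
qed

text \<open>A nonzero homogeneous \<open>z\<close> of degree tau is moved into the corner e_00. Some
  e_ii z is nonzero; then x = e_0i z is fixed by e_00, homogeneous of degree g_0^-1 g_i tau, and
  nonzero since e_i0 x = e_ii z.\<close>

lemma simple_iso_V:
  assumes "gr_simple G A P M"
  obtains h where "h \<in> carrier G" "gr_iso G A (V h) M"
proof -
  have M': "graded_left_module G A P M" using assms by (simp add: gr_simple_def)
  interpret M: graded_left_module G A P M by fact
  obtain y where y: "y \<in> carrier M" "y \<noteq> \<zero>\<^bsub>M\<^esub>"
    using assms M.zero_closed unfolding gr_simple_def by blast
  then obtain \<tau> where \<tau>: "\<tau> \<in> carrier G" "M.gr.comp y \<tau> \<noteq> \<zero>\<^bsub>M\<^esub>"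
    using M.comp_separates by blast
  define z where "z = M.gr.comp y \<tau>"
  have z: "z \<in> gr_part M \<tau>" "z \<in> carrier M" "z \<noteq> \<zero>\<^bsub>M\<^esub>"
    using \<tau> y M.comp_spec(1) M.comp_carrier by (auto simp: z_def)
  obtain i where i: "i < n" "E i i 1 \<odot>\<^bsub>M\<^esub> z \<noteq> \<zero>\<^bsub>M\<^esub>"
    using nonzero_diagonal_part[OF M' z(2,3)] .
  define x where "x = E 0 i 1 \<odot>\<^bsub>M\<^esub> z"
  have smult: "E j k d \<odot>\<^bsub>M\<^esub> (E k l e \<odot>\<^bsub>M\<^esub> z) = E j l (d * e) \<odot>\<^bsub>M\<^esub> z" if "k < n" for j k l d e
    using M.smult_assoc[OF E_carrier[of j k d] E_carrier[of k l e] z(2)]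
      unit_mat_mult_unit_mat[OF that, of n j d n l e]
    by (simp add: ring_mat_simps)
  have "E 0 i 1 \<in> P (inv (g 0) \<otimes> g i)"
    using i n_pos by (intro E_homogeneous) (auto simp: m_assoc D_one)
  then have "x \<in> gr_part M (inv (g 0) \<otimes> g i \<otimes> \<tau>)"
    unfolding x_def using i n_pos \<tau> z by (intro M.smult_graded) auto
  moreover have "E 0 0 1 \<odot>\<^bsub>M\<^esub> x = x" unfolding x_def using smult n_pos by simp
  moreover have "E i 0 1 \<odot>\<^bsub>M\<^esub> x = E i i 1 \<odot>\<^bsub>M\<^esub> z" unfolding x_def using smult n_pos by simp
  then have "x \<noteq> \<zero>\<^bsub>M\<^esub>" using i M.smult_zero_right[OF E_carrier] by auto
  ultimately have "gr_iso G A (V (g 0 \<otimes> (inv (g 0) \<otimes> g i \<otimes> \<tau>))) M"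
    using i n_pos \<tau> by (intro simple_iso_V_of_element[OF _ assms]) auto
  then show ?thesis using that i n_pos \<tau> by (meson g_carrier inv_closed m_closed)
qed

text \<open>\<open>f \<epsilon>\<close> is fixed by e_00, so only its row 0 can be nonzero, and the
  entry there in column j has degree h k_j^-1. Used with \<open>p = 1\<close> for isomorphisms of
  column modules and with \<open>p = n\<close> for embeddings into A.\<close>

lemma hom_V_mat_module:
  assumes h: "h \<in> carrier G" and k: "\<And>j. j < p \<Longrightarrow> k j \<in> carrier G"
    and f: "f \<in> gr_hom G A (V h) (mat_module p k)" "f \<epsilon> \<noteq> 0\<^sub>m n p"
  obtains j where "j < p" "h \<otimes> inv (k j) \<in> H"
proof -
  have part: "f \<epsilon> \<in> gr_part (mat_module p k) (inv (g 0) \<otimes> h)"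
    using gr_homD(4)[OF f(1) _ \<epsilon>_part[OF h]] h n_pos by simp
  then have car: "f \<epsilon> \<in> carrier_mat n p" by (simp add: in_part_iff)
  have "E 0 0 1 * \<epsilon> = \<epsilon>" using unit_mat_mult_unit_mat[OF n_pos, of n 0 "1::'d" 1 0 1] by simp
  then have fix\<epsilon>: "E 0 0 1 * f \<epsilon> = f \<epsilon>"
    using gr_homD(3)[OF f(1) E_carrier, of \<epsilon> 0 0 1] by simp
  obtain i j where ij: "i < n" "j < p" "f \<epsilon> $$ (i, j) \<noteq> 0"
    using f(2) car eq_matI[of "0\<^sub>m n p" "f \<epsilon>"] by fastforce
  have "f \<epsilon> $$ (i, j) = (if i = 0 then f \<epsilon> $$ (0, j) else 0)"
    using unit_mat_mult_index[OF car ij(1,2) n_pos, of 0 1] fix\<epsilon> by simp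
  then have "i = 0" using ij(3) by presburger
  then have "f \<epsilon> $$ (0, j) \<noteq> 0" "f \<epsilon> $$ (0, j) \<in> \<Delta> (g 0 \<otimes> (inv (g 0) \<otimes> h) \<otimes> inv (k j))"
    using ij part by (auto simp: in_part_iff)
  then have "h \<otimes> inv (k j) \<in> H" using h k[OF ij(2)] n_pos by (subst supp_iff) auto
  then show ?thesis using that ij by blast
qed

lemma V_iso_iff:
  assumes "h \<in> carrier G" "k \<in> carrier G"
  shows "gr_iso G A (V h) (V k) \<longleftrightarrow> h \<otimes> inv k \<in> H"
proof
  assume "gr_iso G A (V h) (V k)"
  then obtain f where f: "f \<in> gr_hom G A (V h) (V k)" "inj_on f (carrier (V h))"
    unfolding gr_iso_def bij_betw_def by blast
  have "f \<epsilon> \<noteq> 0\<^sub>m n 1" using hom_V_\<epsilon>_nonzero[OF assms(1) V_graded[OF assms(2)] f] by simp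
  then show "h \<otimes> inv k \<in> H" using hom_V_mat_module[OF assms(1) _ f(1)] assms(2) by blast
next
  assume "h \<otimes> inv k \<in> H"
  then obtain d where d: "d \<in> \<Delta> (h \<otimes> inv k)" "d \<noteq> 0" using supp_iff supp_carrier by blast
  then obtain e where e: "e * d = 1" "d * e = 1" using D_inverse assms by blast
  \<comment> \<open>Right multiplication by a unit of degree h k^-1 is the isomorphism from
    \<open>V h\<close> to \<open>V k\<close>.\<close>
  let ?b = "unit_mat 1 1 0 0 d" and ?c = "unit_mat 1 1 0 0 e"
  have "(\<lambda>a. a * ?b) \<in> gr_hom G A (V h) (V k)"
    using assms d by (intro right_mult_hom) auto
  moreover have bc: "?b * ?c = 1\<^sub>m 1" "?c * ?b = 1\<^sub>m 1"
    using e by (auto simp: unit_mat_mult_unit_mat intro!: eq_matI)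
  have inverse: "(w * ?b) * ?c = w" "(w * ?c) * ?b = w" if "w \<in> carrier_mat n 1" for w
    using that bc by (simp_all add: assoc_mult_mat[of _ n 1 _ 1 _ 1])
  have "bij_betw (\<lambda>a. a * ?b) (carrier (V h)) (carrier (V k))"
    by (rule bij_betw_byWitness[where f' = "\<lambda>a. a * ?c"]) (use inverse in auto)
  ultimately show "gr_iso G A (V h) (V k)" unfolding gr_iso_def by blast
qed

section \<open>The right coset attached to a graded simple module\<close>

definition iso_coset :: "('d mat, 'e, 'a) gr_module \<Rightarrow> 'a set" where
  "iso_coset M = {h \<in> carrier G. gr_iso G A (V h) M}"

text \<open>By transitivity the labels of \<open>M\<close> are the k with \<open>V k\<close>
  isomorphic to \<open>V h\<close>, that is, with k h^-1 in the support. Collecting all labels makes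
  the invariant independent of the chosen h.\<close>

lemma iso_coset_eq:
  assumes "graded_left_module G A P M" "h \<in> carrier G" "gr_iso G A (V h) M"
  shows "iso_coset M = H #> h"
proof -
  interpret H: subgroup H G by (rule subgroup_supp)
  have "gr_iso G A (V k) M \<longleftrightarrow> gr_iso G A (V k) (V h)" if "k \<in> carrier G" for k
    using gr_iso_trans[OF _ assms(3)] gr_iso_trans[OF _ gr_iso_sym[OF V_graded[OF assms(2)] assms(1,3)]]
    by blast
  then have "iso_coset M = {k \<in> carrier G. k \<otimes> inv h \<in> H}"
    unfolding iso_coset_def using V_iso_iff assms(2) by blast
  then show ?thesis
    using H.rcos_module[OF is_group assms(2)] r_coset_subset_G[OF H.subset assms(2)] by blast
qed

lemma iso_coset_simple:
  assumes "gr_simple G A P M"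
  shows "iso_coset M \<in> rcosets H" "iso_coset M \<noteq> {}"
proof -
  obtain h where h: "h \<in> carrier G" "gr_iso G A (V h) M" using simple_iso_V[OF assms] .
  then show "iso_coset M \<noteq> {}" by (auto simp: iso_coset_def)
  have "iso_coset M = H #> h" using assms h by (intro iso_coset_eq) (auto simp: gr_simple_def)
  then show "iso_coset M \<in> rcosets H"
    using rcosetsI subgroup.subset[OF subgroup_supp] h by simp
qed

lemma gr_iso_iff_iso_coset:
  assumes "gr_simple G A P M" "gr_simple G A P N"
  shows "gr_iso G A M N \<longleftrightarrow> iso_coset M = iso_coset N"
proof
  have graded: "graded_left_module G A P M" "graded_left_module G A P N"
    using assms by (simp_all add: gr_simple_def)
  obtain h where h: "h \<in> carrier G" "gr_iso G A (V h) M" using simple_iso_V[OF assms(1)] .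
  {
    assume "gr_iso G A M N"
    then have "gr_iso G A (V h) N" using h gr_iso_trans by blast
    then show "iso_coset M = iso_coset N" 
      using iso_coset_eq[OF graded(1) h] iso_coset_eq[OF graded(2) h(1)] by simp
  next
    assume "iso_coset M = iso_coset N"
    then have "gr_iso G A (V h) N" using h by (auto simp: iso_coset_def)
    then show "gr_iso G A M N"
      using gr_iso_trans gr_iso_sym[OF V_graded[OF h(1)] graded(1) h(2)] by blast
  }
qed

text \<open>Columns embed into square matrices as first columns, and \<iota> embeds these into
  \<open>'m\<close>; transporting \<open>V h\<close> along the composite realizes the coset of
  \<open>h\<close> inside the universe.\<close>

lemma ex_simple_with_coset:
  fixes \<iota> :: "'d mat \<Rightarrow> 'm"
  assumes "inj_on \<iota> (carrier_mat n n)" "C \<in> rcosets H"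
  obtains M :: "('d mat, 'm, 'a) gr_module" where "gr_simple G A P M" "iso_coset M = C"
proof -
  obtain h where h: "h \<in> carrier G" "C = H #> h" using assms(2) by (auto simp: RCOSETS_def)
  let ?u = "unit_mat 1 n 0 0 (1::'d)"
  have "inj_on (\<lambda>v. v * ?u) (carrier_mat n 1)"
    by (rule inj_on_inverseI[where g = "\<lambda>v. v * \<epsilon>"]) (rule \<epsilon>_generates)
  moreover have "(\<lambda>v. v * ?u) ` carrier_mat n 1 \<subseteq> carrier_mat n n" by auto
  ultimately have "inj_on (\<lambda>v. \<iota> (v * ?u)) (carrier (V h))"
    using assms(1) by (auto simp: inj_on_def subset_iff)
  note M = gr_transport[OF V_graded[OF h(1)] this]
  then show ?thesis using that[OF simple_of_iso_V[OF h(1)]] iso_coset_eq[OF M(1) h(1)] h(2) by blast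
qed


section \<open>Multiplicities\<close>

abbreviation reg where "reg \<equiv> mat_module n g"

lemma E_mult_carrier [simp]: "x \<in> carrier_mat n p \<Longrightarrow> E i j d * x \<in> carrier_mat n p"
  by (rule mult_carrier_mat[of _ n n]) auto

lemma finsum_mat_module_index:
  assumes "finite K" "\<And>k. k \<in> K \<Longrightarrow> f k \<in> carrier_mat n p" "i < n" "j < p"
  shows "finsum (mat_module p h) f K $$ (i, j) = (\<Sum>k\<in>K. f k $$ (i, j))"
  using assms(1,2)
proof (induction K)
  case empty
  interpret M: abelian_group "mat_module p h" by (rule abelian_group_mat_module)
  show ?case using assms(3,4) by simp
next
  case (insert k K)
  interpret M: abelian_group "mat_module p h" by (rule abelian_group_mat_module)
  have f: "f \<in> K \<rightarrow> carrier (mat_module p h)" "f k \<in> carrier (mat_module p h)"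
    using insert.prems by auto
  then have "finsum (mat_module p h) f K \<in> carrier (mat_module p h)" by (intro M.finsum_closed)
  then have "dim_row (finsum (mat_module p h) f K) = n" "dim_col (finsum (mat_module p h) f K) = p"
    by auto
  then show ?case using insert f assms(3,4) by (simp add: M.finsum_insert)
qed

lemma finsum_reg_carrier:
  assumes "\<And>k. k \<in> K \<Longrightarrow> f k \<in> carrier_mat n n"
  shows "finsum reg f K \<in> carrier_mat n n"
proof -
  interpret M: abelian_group reg by (rule abelian_group_mat_module)
  have "finsum reg f K \<in> carrier reg" using assms by (intro M.finsum_closed) auto
  then show ?thesis by simp
qed

section \<open>The decomposition of A into its columns\<close>

definition col_module :: "nat \<Rightarrow> 'd mat set" where
  "col_module k = (\<lambda>v. v * unit_mat 1 n 0 k 1) ` carrier_mat n 1"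

lemma col_module_iff:
  assumes "k < n"
  shows "a \<in> col_module k \<longleftrightarrow>
    a \<in> carrier_mat n n \<and> (\<forall>r<n. \<forall>s<n. s \<noteq> k \<longrightarrow> a $$ (r, s) = 0)"
proof
  assume "a \<in> col_module k"
  then show "a \<in> carrier_mat n n \<and> (\<forall>r<n. \<forall>s<n. s \<noteq> k \<longrightarrow> a $$ (r, s) = 0)"
    by (auto simp: col_module_def mult_unit_mat_index[of _ n 1] simp del: index_mult_mat(1))
next
  assume a: "a \<in> carrier_mat n n \<and> (\<forall>r<n. \<forall>s<n. s \<noteq> k \<longrightarrow> a $$ (r, s) = 0)"
  \<comment> \<open>Column \<open>k\<close> is extracted and put back, which amounts to multiplying
    by e_kk.\<close>
  have "(a * unit_mat n 1 k 0 1) * unit_mat 1 n 0 k 1 = a * E k k 1"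
    using a unit_mat_mult_unit_mat[of 0 1 n k 1 n k "1::'d"]
    by (subst assoc_mult_mat[of _ n n _ 1 _ n]) auto
  also have "\<dots> = a"
    using a assms by (auto intro!: eq_matI simp: mult_unit_mat_index[of _ n n] simp del: index_mult_mat(1))
  finally show "a \<in> col_module k"
    unfolding col_module_def using a by (intro image_eqI[where x = "a * unit_mat n 1 k 0 1"]) auto
qed

text \<open>The entry 1 at (0, k) has degree g_k g_k^-1 = 1, which is why column \<open>k\<close> of
  A carries the label \<open>g k\<close>. Extracting that column is a left inverse.\<close>

lemma col_embedding:
  assumes "k < n"
  shows "(\<lambda>v. v * unit_mat 1 n 0 k 1) \<in> gr_hom G A (V (g k)) reg"
    and "inj_on (\<lambda>v. v * unit_mat 1 n 0 k (1::'d)) (carrier (V (g k)))"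
proof -
  show "(\<lambda>v. v * unit_mat 1 n 0 k 1) \<in> gr_hom G A (V (g k)) reg"
    using assms by (intro right_mult_hom) (auto simp: D_zero D_one)
  have "(v * unit_mat 1 n 0 k 1) * unit_mat n 1 k 0 1 = v" if "v \<in> carrier_mat n 1" for v :: "'d mat"
  proof -
    have "unit_mat 1 n 0 k 1 * unit_mat n 1 k 0 1 = (1\<^sub>m 1 :: 'd mat)"
      using assms by (auto simp: unit_mat_mult_unit_mat intro!: eq_matI)
    then show ?thesis using that by (subst assoc_mult_mat[of _ n 1 _ n _ 1]) auto
  qed
  then show "inj_on (\<lambda>v. v * unit_mat 1 n 0 k (1::'d)) (carrier (V (g k)))"
    by (intro inj_on_inverseI[where g = "\<lambda>v. v * unit_mat n 1 k 0 1"]) simp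
qed

lemma col_module:
  assumes "k < n"
  shows "gr_submodule G A reg (col_module k)"
    and "gr_iso G A (V (g k)) (gr_restrict reg (col_module k))"
    and "gr_simple G A P (gr_restrict reg (col_module k))"
proof -
  note col = col_embedding[OF assms] and V = V_graded[OF g_carrier[OF assms]]
  show sub: "gr_submodule G A reg (col_module k)"
    using gr_hom_image[OF V A_graded col(1)] by (simp add: col_module_def)
  show iso: "gr_iso G A (V (g k)) (gr_restrict reg (col_module k))"
    using gr_iso_image[OF V col] by (simp add: col_module_def)
  interpret reg: graded_left_module G A P reg by (rule A_graded)
  show "gr_simple G A P (gr_restrict reg (col_module k))"
    using simple_of_iso_V[OF g_carrier[OF assms] _ iso] reg.graded_left_module_restrict[OF sub P_carrier]
    by blast
qed

lemma col_decomposition: "gr_simple_decomposition G A P reg n col_module"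
  unfolding gr_simple_decomposition_def
proof (intro conjI allI impI ballI)
  fix x assume "x \<in> carrier reg"
  then have x: "x \<in> carrier_mat n n" by simp
  define y where "y = (\<lambda>k\<in>{..<n}. mat n n (\<lambda>(r, s). if s = k then x $$ (r, s) else 0))"
  have y: "y \<in> (\<Pi>\<^sub>E k\<in>{..<n}. col_module k)" by (auto simp: y_def col_module_iff)
  \<comment> \<open>Only the summand \<open>z s\<close> has nonzero entries in column
    \<open>s\<close>, so the sum determines \<open>z\<close>.\<close>
  have index: "finsum reg z {..<n} $$ (r, s) = z s $$ (r, s)"
    if z: "z \<in> (\<Pi>\<^sub>E k\<in>{..<n}. col_module k)" and rs: "r < n" "s < n" for z r s
  proof -
    have z': "z k \<in> col_module k" if "k < n" for k using z that by auto
    have "finsum reg z {..<n} $$ (r, s) = (\<Sum>k<n. z k $$ (r, s))"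
      using z' rs by (intro finsum_mat_module_index) (auto simp: col_module_iff)
    also have "\<dots> = (\<Sum>k<n. if k = s then z s $$ (r, s) else 0)"
    proof (rule sum.cong)
      fix k assume "k \<in> {..<n}"
      then show "z k $$ (r, s) = (if k = s then z s $$ (r, s) else 0)"
        using z'[of k] rs by (auto simp: col_module_iff)
    qed simp
    finally show ?thesis using rs by simp
  qed
  show "\<exists>!y. y \<in> (\<Pi>\<^sub>E k\<in>{..<n}. col_module k) \<and> x = finsum reg y {..<n}"
  proof (rule ex1I[of _ y])
    have "finsum reg y {..<n} \<in> carrier_mat n n"
      by (rule finsum_reg_carrier) (simp add: y_def)
    then show "y \<in> (\<Pi>\<^sub>E k\<in>{..<n}. col_module k) \<and> x = finsum reg y {..<n}"
      using y x index[OF y] by (auto intro!: eq_matI simp: y_def)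
    fix z assume z: "z \<in> (\<Pi>\<^sub>E k\<in>{..<n}. col_module k) \<and> x = finsum reg z {..<n}"
    show "z = y"
    proof (rule PiE_ext)
      fix k assume k: "k \<in> {..<n}"
      then have zk: "z k \<in> col_module k" using z by blast
      show "z k = y k"
      proof (rule eq_matI)
        fix r s assume "r < dim_row (y k)" "s < dim_col (y k)"
        then have rs: "r < n" "s < n" using k by (auto simp: y_def)
        have "x $$ (r, s) = z s $$ (r, s)" using index[of z r s] z rs by simp
        then show "z k $$ (r, s) = y k $$ (r, s)"
          using zk k rs by (auto simp: y_def col_module_iff)
      qed (use zk k in \<open>auto simp: y_def col_module_iff\<close>)
    qed (use z y in auto)
  qed
qed (use col_module in auto)

lemma coset_membership:
  assumes "graded_left_module G A P M" "h \<in> carrier G" "gr_iso G A (V h) M" "j < n"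
  shows "g j \<in> iso_coset M \<longleftrightarrow> h \<otimes> inv (g j) \<in> H"
proof -
  have "gr_iso G A (V (g j)) M \<longleftrightarrow> gr_iso G A (V h) (V (g j))"
    using gr_iso_trans gr_iso_sym assms V_graded g_carrier by metis
  then show ?thesis using V_iso_iff assms by (simp add: iso_coset_def)
qed

text \<open>The degree \<open>inv (g 0) \<otimes> h\<close> part of the first row of \<open>A\<close> is a left vector space over the division
  ring \<open>\<Delta> \<one>\<close>. Every summand isomorphic to \<open>V h\<close> contributes one dimension to it and every other
  summand none, so that its dimension is the multiplicity of \<open>V h\<close>.\<close>

lemma decomposition_multiplicity:
  assumes dec: "gr_simple_decomposition G A P reg m S" and M: "gr_simple G A P M"
  shows "card {k. k < m \<and> gr_iso G A (gr_restrict reg (S k)) M} = card {j. j < n \<and> g j \<in> iso_coset M}"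
proof -
  interpret reg: graded_left_module G A P reg by (rule A_graded)
  have S: "gr_submodule G A reg (S k)" "gr_simple G A P (gr_restrict reg (S k))" if "k < m" for k
    using dec that unfolding gr_simple_decomposition_def by blast+
  have S_graded: "graded_left_module G A P (gr_restrict reg (S k))" if "k < m" for k
    using S(2)[OF that] by (simp add: gr_simple_def)
  have S_carrier: "x \<in> carrier_mat n n" if "k < m" "x \<in> S k" for k x
    using reg.gr_submoduleD(1)[OF S(1)] that by auto
  have unique: "y = z" if "y \<in> (\<Pi>\<^sub>E k\<in>{..<m}. S k)" "z \<in> (\<Pi>\<^sub>E k\<in>{..<m}. S k)"
    "finsum reg y {..<m} = finsum reg z {..<m}" for y z
  proof -
    have "finsum reg y {..<m} \<in> carrier reg"
      using finsum_reg_carrier[of "{..<m}" y] that(1) S_carrier by fastforce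
    then have "\<exists>!y'. y' \<in> (\<Pi>\<^sub>E k\<in>{..<m}. S k) \<and> finsum reg y {..<m} = finsum reg y' {..<m}"
      using dec unfolding gr_simple_decomposition_def by blast
    then show ?thesis using that by blast
  qed
  have M': "graded_left_module G A P M" using M by (simp add: gr_simple_def)
  obtain h where h: "h \<in> carrier G" "gr_iso G A (V h) M" using simple_iso_V[OF M] .
  \<comment> \<open>The degree of \<epsilon> in \<open>V h\<close>.\<close>
  define \<tau> where "\<tau> = inv (g 0) \<otimes> h"
  have \<tau>: "\<tau> \<in> carrier G" "g 0 \<otimes> \<tau> = h" using h n_pos by (simp_all add: \<tau>_def)
  define K where "K = {k. k < m \<and> gr_iso G A (gr_restrict reg (S k)) M}"
  define J where "J = {j. j < n \<and> g j \<in> iso_coset M}"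
  have finite: "finite K" "finite J" by (simp_all add: K_def J_def)
  have iso_V: "gr_iso G A (V h) (gr_restrict reg (S k)) \<longleftrightarrow> k \<in> K" if "k < m" for k
  proof
    assume "gr_iso G A (V h) (gr_restrict reg (S k))"
    from gr_iso_trans[OF gr_iso_sym[OF V_graded[OF h(1)] S_graded[OF that] this] h(2)]
    show "k \<in> K" using that by (simp add: K_def)
  next
    assume "k \<in> K"
    then have "gr_iso G A (gr_restrict reg (S k)) M" by (simp add: K_def)
    from gr_iso_trans[OF h(2) gr_iso_sym[OF S_graded[OF that] M' this]]
    show "gr_iso G A (V h) (gr_restrict reg (S k))" .
  qed
  have J_iff: "j \<in> J \<longleftrightarrow> h \<otimes> inv (g j) \<in> H" if "j < n" for j
    using coset_membership[OF M' h that] that by (simp add: J_def)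
  \<comment> \<open>The possible images of \<epsilon> under graded homomorphisms from
    \<open>V h\<close> to A.\<close>
  define F where "F = {x \<in> gr_part reg \<tau>. E 0 0 1 * x = x}"
  have F_carrier: "x \<in> carrier_mat n n" if "x \<in> F" for x using that by (simp add: F_def in_part_iff)
  have F_entry: "x $$ (0, l) \<in> \<Delta> (h \<otimes> inv (g l))" if "x \<in> F" "l < n" for x l
    using that n_pos \<tau> by (auto simp: F_def in_part_iff)
  have E_index: "(E 0 0 d * x) $$ (r, l) = (if r = 0 then d * x $$ (0, l) else 0)"
    if "x \<in> carrier_mat n n" "r < n" "l < n" for x :: "'d mat" and d r l
    by (rule unit_mat_mult_index[OF that n_pos])

  have "\<forall>k\<in>K. \<exists>f. f \<in> gr_hom G A (V h) (gr_restrict reg (S k)) \<and> bij_betw f (carrier (V h)) (S k)"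
    using iso_V unfolding gr_iso_def K_def by auto
  then obtain f where f: "\<And>k. k \<in> K \<Longrightarrow> f k \<in> gr_hom G A (V h) (gr_restrict reg (S k))"
    "\<And>k. k \<in> K \<Longrightarrow> bij_betw (f k) (carrier (V h)) (S k)" by metis
  define s where "s = (\<lambda>k. f k \<epsilon>)"
  have E\<epsilon>: "E 0 0 d * \<epsilon> = unit_mat n 1 0 0 d" for d
    using unit_mat_mult_unit_mat[OF n_pos, of n 0 d 1 0 1] by simp
  have s: "s k \<in> S k" "s k \<in> F" "s k \<noteq> 0\<^sub>m n n" "s k \<in> carrier_mat n n" if "k \<in> K" for k
  proof -
    have k: "k < m" using that by (simp add: K_def)
    show "s k \<in> S k" using gr_homD(1)[OF f(1)[OF that], of \<epsilon>] by (simp add: s_def)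
    then show "s k \<in> carrier_mat n n" using S_carrier k by blast
    have "inj_on (f k) (carrier (V h))" using f(2)[OF that] by (simp add: bij_betw_def)
    then show "s k \<noteq> 0\<^sub>m n n"
      using hom_V_\<epsilon>_nonzero[OF h(1) S_graded[OF k] f(1)[OF that]] by (simp add: s_def)
    have "s k \<in> gr_part reg \<tau>"
      using gr_homD(4)[OF f(1)[OF that] \<tau>(1) \<epsilon>_part[OF h(1), folded \<tau>_def]] by (simp add: s_def)
    moreover have "E 0 0 1 * s k = s k"
      using gr_homD(3)[OF f(1)[OF that] E_carrier[of 0 0 1], of \<epsilon>] E\<epsilon>[of 1] by (simp add: s_def)
    ultimately show "s k \<in> F" by (simp add: F_def)
  qed
  \<comment> \<open>Pulled back along \<open>f k\<close>, \<open>x\<close> becomes a column of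
    degree \<tau> fixed by e_00. Its only possibly nonzero entry \<open>d\<close> is in row 0 and
    has degree g_0 tau h^-1 = 1.\<close>
  have s_span: "\<exists>d\<in>\<Delta> \<one>. x = E 0 0 d * s k" if k: "k \<in> K" and x: "x \<in> S k" "x \<in> F" for k x
  proof -
    have "k < m" using k by (simp add: K_def)
    have inj: "inj_on (f k) (carrier (V h))" using f(2)[OF k] by (simp add: bij_betw_def)
    obtain w where w: "w \<in> carrier_mat n 1" "x = f k w"
      using f(2)[OF k] x(1) by (auto simp: bij_betw_def)
    have w_part: "w \<in> gr_part (V h) \<tau>"
      using gr_hom_part_preimage[OF V_graded[OF h(1)] S_graded[OF \<open>k < m\<close>] f(1)[OF k] inj _ \<tau>(1), of w] x w
      by (auto simp: F_def)
    define d where "d = w $$ (0, 0)"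
    have d: "d \<in> \<Delta> \<one>" using w_part n_pos h \<tau> by (auto simp: d_def in_part_iff)
    have "f k (E 0 0 1 * w) = f k w"
      using gr_homD(3)[OF f(1)[OF k] E_carrier[of 0 0 1], of w] w x by (simp add: F_def)
    then have "E 0 0 1 * w = w" using inj_onD[OF inj] w by simp
    then have "w $$ (r, 0) = (if r = 0 then d else 0)" if "r < n" for r
      using unit_mat_mult_index[OF w(1) that _ n_pos, of 0 0 1] by (simp add: d_def)
    then have "w = unit_mat n 1 0 0 d"
      using w(1) by (intro eq_matI) auto
    then have "w = E 0 0 d * \<epsilon>" using E\<epsilon> by simp
    then have "x = E 0 0 d * s k"
      using gr_homD(3)[OF f(1)[OF k] E_carrier[of 0 0 d], of \<epsilon>] w(2) by (simp add: s_def)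
    then show ?thesis using d by blast
  qed
  \<comment> \<open>By Schur's argument a nonzero vector of \<open>F\<close> in \<open>S k\<close>
    would make \<open>S k\<close> isomorphic to \<open>V h\<close>.\<close>
  have zero_part: "x = 0\<^sub>m n n" if "k < m" "k \<notin> K" "x \<in> S k" "x \<in> F" for k x
  proof (rule ccontr)
    assume "x \<noteq> 0\<^sub>m n n"
    then have "gr_iso G A (V (g 0 \<otimes> \<tau>)) (gr_restrict reg (S k))"
      using that by (intro simple_iso_V_of_element[OF \<tau>(1) S(2)]) (auto simp: F_def)
    then show False using iso_V that \<tau> by simp
  qed
  have F_dec: "\<exists>y\<in>(\<Pi>\<^sub>E k\<in>{..<m}. S k \<inter> F). x = finsum reg y {..<m}" if x: "x \<in> F" for x
  proof -
    obtain y where y: "y \<in> (\<Pi>\<^sub>E k\<in>{..<m}. S k)" "x = finsum reg y {..<m}"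
      using dec F_carrier[OF x] unfolding gr_simple_decomposition_def mat_module_simps by blast
    have yS: "y k \<in> S k" and yc: "y k \<in> carrier_mat n n" if "k < m" for k
      using y(1) S_carrier that by blast+
    \<comment> \<open>Taking components of degree \<tau> and multiplying by e_00 both preserve every
      summand and fix \<open>x\<close>; by uniqueness of the decomposition they fix every
      \<open>y k\<close>.\<close>
    let ?y1 = "\<lambda>k\<in>{..<m}. reg.gr.comp (y k) \<tau>" and ?y2 = "\<lambda>k\<in>{..<m}. E 0 0 1 * y k"
    have "finsum reg ?y1 {..<m} = finsum reg (\<lambda>k. reg.gr.comp (y k) \<tau>) {..<m}"
      using yc reg.comp_carrier by (intro reg.M.finsum_cong') auto
    also have "\<dots> = reg.gr.comp x \<tau>"
      unfolding y(2) using yc by (intro reg.comp_finsum[symmetric] \<tau>) auto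
    also have "\<dots> = x" using reg.comp_part[OF \<tau>(1), of x] x by (simp add: F_def)
    finally have "finsum reg ?y1 {..<m} = finsum reg y {..<m}" using y by simp
    then have y1: "?y1 = y"
      using y yS by (intro unique) (auto intro!: reg.comp_gr_submodule S \<tau>)
    have "finsum reg ?y2 {..<m} = E 0 0 1 * x"
    proof (rule eq_matI)
      fix r l assume "r < dim_row (E 0 0 1 * x)" "l < dim_col (E 0 0 1 * x)"
      then have rl: "r < n" "l < n" using F_carrier[OF x] by auto
      have "finsum reg ?y2 {..<m} $$ (r, l) = (\<Sum>k<m. ?y2 k $$ (r, l))"
        using rl by (intro finsum_mat_module_index) (use yc in auto)
      also have "\<dots> = (\<Sum>k<m. if r = 0 then y k $$ (0, l) else 0)"
        using E_index[OF yc rl, of _ 1] by (intro sum.cong) (auto simp del: index_mult_mat(1))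
      also have "\<dots> = (if r = 0 then x $$ (0, l) else 0)"
        using finsum_mat_module_index[of "{..<m}" y n 0 l g] yc n_pos rl y(2) by simp
      finally show "finsum reg ?y2 {..<m} $$ (r, l) = (E 0 0 1 * x) $$ (r, l)"
        using E_index[OF F_carrier[OF x] rl, of 1] by simp
    next
      have "finsum reg ?y2 {..<m} \<in> carrier_mat n n"
        using yc by (intro finsum_reg_carrier) auto
      then show "dim_row (finsum reg ?y2 {..<m}) = dim_row (E 0 0 1 * x)"
        "dim_col (finsum reg ?y2 {..<m}) = dim_col (E 0 0 1 * x)" using F_carrier[OF x] by auto
    qed
    then have "finsum reg ?y2 {..<m} = finsum reg y {..<m}" using x y by (simp add: F_def)
    then have y2: "?y2 = y"
      using y yS reg.gr_submoduleD(5)[OF S(1) E_carrier] by (intro unique) auto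
    have "y k \<in> F" if "k < m" for k
      using that fun_cong[OF y1, of k] fun_cong[OF y2, of k] reg.comp_spec(1)[of "y k" \<tau>] yc \<tau>(1)
      by (simp add: F_def)
    then show ?thesis using y by (intro bexI[of _ y]) auto
  qed
  have "\<exists>u\<in>\<Delta> (h \<otimes> inv (g j)). u \<noteq> 0" if "j \<in> J" for j
    using J_iff[of j] supp_iff[of "h \<otimes> inv (g j)"] supp_carrier that by (auto simp: J_def)
  then obtain u where u: "\<And>j. j \<in> J \<Longrightarrow> u j \<in> \<Delta> (h \<otimes> inv (g j))" "\<And>j. j \<in> J \<Longrightarrow> u j \<noteq> 0"
    by metis
  have "\<exists>e\<in>\<Delta> (inv (h \<otimes> inv (g j))). e * u j = 1 \<and> u j * e = 1" if "j \<in> J" for j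
    using D_inverse[OF _ u(1)[OF that] u(2)[OF that]] h(1) that by (simp add: J_def)
  then obtain u' where u': "\<And>j. j \<in> J \<Longrightarrow> u' j \<in> \<Delta> (inv (h \<otimes> inv (g j)))"
    "\<And>j. j \<in> J \<Longrightarrow> u' j * u j = 1" "\<And>j. j \<in> J \<Longrightarrow> u j * u' j = 1" by metis
  \<comment> \<open>\<open>r j\<close> is row 0 of \<open>E 0 j (u j)\<close>. These rows form the
    standard basis of \<open>F\<close>, to be compared with the basis \<open>s\<close>.\<close>
  define r where "r = (\<lambda>j l. if l = j then u j else 0)"

  have "card K \<le> card J"
  proof (rule card_independent_le_spanning_D[where s = "\<lambda>k l. s k $$ (0, l)" and r = r and L = "{..<n}"])
    fix k assume k: "k \<in> K"
    \<comment> \<open>Chosen so that \<open>c j * u j\<close> is entry \<open>j\<close> of the row;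
      its degree is 1 because the degrees of the two factors are inverse to each other.\<close>
    define c where "c = (\<lambda>j. s k $$ (0, j) * u' j)"
    have "c j \<in> \<Delta> \<one>" if j: "j \<in> J" for j
    proof -
      have jn: "j < n" using j by (simp add: J_def)
      then have "c j \<in> \<Delta> (h \<otimes> inv (g j) \<otimes> inv (h \<otimes> inv (g j)))"
        unfolding c_def using F_entry[OF s(2)[OF k] jn] u'(1)[OF j] h(1) by (intro D_mult) auto
      then show ?thesis using h(1) jn by simp
    qed
    moreover have "s k $$ (0, l) = (\<Sum>j\<in>J. c j * r j l)" if l: "l < n" for l
    proof -
      have "(\<Sum>j\<in>J. c j * r j l) = (\<Sum>j\<in>J. if l = j then c j * u j else 0)"
        by (intro sum.cong) (auto simp: r_def)
      also have "\<dots> = (if l \<in> J then c l * u l else 0)" using finite(2) by simp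
      also have "\<dots> = s k $$ (0, l)"
      proof (cases "l \<in> J")
        case True
        then show ?thesis using u'(2)[of l] by (simp add: c_def mult.assoc)
      next
        \<comment> \<open>Outside \<open>J\<close> the degree h g_l^-1 is not in the support, so the
          entry vanishes.\<close>
        case False
        then show ?thesis using J_iff[OF l] supp_iff[of "h \<otimes> inv (g l)"] F_entry[OF s(2)[OF k] l] h(1) l by auto
      qed
      finally show ?thesis by simp
    qed
    ultimately show "\<exists>c. (\<forall>j\<in>J. c j \<in> \<Delta> \<one>) \<and> (\<forall>l\<in>{..<n}. s k $$ (0, l) = (\<Sum>j\<in>J. c j * r j l))"
      by (intro exI[of _ c]) auto
  next
    fix x k
    assume x: "\<And>k. k \<in> K \<Longrightarrow> x k \<in> \<Delta> \<one>"
      and sum0: "\<And>l. l \<in> {..<n} \<Longrightarrow> (\<Sum>k\<in>K. x k * s k $$ (0, l)) = 0" and k: "k \<in> K"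
    \<comment> \<open>A relation among the vectors \<open>s k\<close> gives two decompositions of
      zero: \<open>y\<close>, formed by the terms of the relation and padded by zeros outside
      \<open>K\<close>, and the trivial one \<open>z\<close>.\<close>
    define y where "y = (\<lambda>k\<in>{..<m}. if k \<in> K then E 0 0 (x k) * s k else 0\<^sub>m n n)"
    define z where "z = (\<lambda>k\<in>{..<m}. 0\<^sub>m n n :: 'd mat)"
    have S0: "0\<^sub>m n n \<in> S k" if "k < m" for k using reg.gr_submoduleD(2)[OF S(1)[OF that]] by simp
    have yP: "y \<in> (\<Pi>\<^sub>E k\<in>{..<m}. S k)"
      using S0 s(1) reg.gr_submoduleD(5)[OF S(1) E_carrier] by (auto simp: y_def)
    have zP: "z \<in> (\<Pi>\<^sub>E k\<in>{..<m}. S k)" using S0 by (auto simp: z_def)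
    have yc: "y k \<in> carrier_mat n n" "z k \<in> carrier_mat n n" if "k < m" for k
      using yP zP S_carrier that by blast+
    have "finsum reg y {..<m} = finsum reg z {..<m}"
    proof (rule eq_matI)
      have c: "finsum reg y {..<m} \<in> carrier_mat n n" "finsum reg z {..<m} \<in> carrier_mat n n"
        using yc by (intro finsum_reg_carrier; simp)+
      then show "dim_row (finsum reg y {..<m}) = dim_row (finsum reg z {..<m})"
        "dim_col (finsum reg y {..<m}) = dim_col (finsum reg z {..<m})" by auto
      fix i l assume "i < dim_row (finsum reg z {..<m})" "l < dim_col (finsum reg z {..<m})"
      then have il: "i < n" "l < n" using c by auto
      have "finsum reg y {..<m} $$ (i, l) = (\<Sum>k<m. y k $$ (i, l))"
        using yc il by (intro finsum_mat_module_index) auto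
      also have "\<dots> = (\<Sum>k\<in>K. y k $$ (i, l))"
        using il by (intro sum.mono_neutral_right) (auto simp: K_def y_def)
      also have "\<dots> = (\<Sum>k\<in>K. if i = 0 then x k * s k $$ (0, l) else 0)"
      proof (rule sum.cong)
        fix k assume k: "k \<in> K"
        then have "y k = E 0 0 (x k) * s k" by (simp add: y_def K_def)
        then show "y k $$ (i, l) = (if i = 0 then x k * s k $$ (0, l) else 0)"
          using E_index[OF s(4)[OF k] il] by simp
      qed simp
      also have "\<dots> = 0" using sum0 il by (cases "i = 0") simp_all
      also have "0 = (\<Sum>k<m. z k $$ (i, l))" using il by (simp add: z_def)
      also have "\<dots> = finsum reg z {..<m} $$ (i, l)"
        using yc il by (intro finsum_mat_module_index[symmetric]) auto
      finally show "finsum reg y {..<m} $$ (i, l) = finsum reg z {..<m} $$ (i, l)" .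
    qed
    then have "y k = z k" using unique[OF yP zP] by simp
    then have 0: "E 0 0 (x k) * s k = 0\<^sub>m n n" using k by (simp add: y_def z_def K_def)
    show "x k = 0"
    proof (rule ccontr)
      assume "x k \<noteq> 0"
      \<comment> \<open>A nonzero scalar is invertible, so the vanishing of its multiple of
        \<open>s k\<close> would force \<open>s k\<close> itself to vanish.\<close>
      then obtain e where e: "e * x k = 1" using D_inverse[OF one_closed x[OF k]] by blast
      have "s k = E 0 0 1 * s k" using s(2)[OF k] by (simp add: F_def)
      also have "E 0 0 1 = E 0 0 e * E 0 0 (x k)" using e unit_mat_mult_unit_mat[OF n_pos, of n 0 e] by simp
      also have "\<dots> * s k = E 0 0 e * (E 0 0 (x k) * s k)"
        using s(4)[OF k] by (intro assoc_mult_mat) auto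
      finally show False using 0 s(3)[OF k] by simp
    qed
  qed (use finite in auto)
  moreover have "card J \<le> card K"
  proof (rule card_independent_le_spanning_D[where r = "\<lambda>k l. s k $$ (0, l)" and s = r and L = "{..<n}"])
    fix j assume j: "j \<in> J"
    then have jn: "j < n" by (simp add: J_def)
    \<comment> \<open>Decomposing this matrix inside \<open>F\<close> leaves only terms from
      summands in \<open>K\<close>, each a scalar multiple of \<open>s k\<close>; its row 0 is
      \<open>r j\<close>.\<close>
    have "E 0 j (u j) \<in> F"
      using u(1)[OF j] E_homogeneous[OF n_pos jn \<tau>(1), of "u j"] \<tau>(2)
        unit_mat_mult_unit_mat[OF n_pos, of n 0 1 n j "u j"] by (simp add: F_def P_eq)
    then obtain y where y: "y \<in> (\<Pi>\<^sub>E k\<in>{..<m}. S k \<inter> F)" "E 0 j (u j) = finsum reg y {..<m}"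
      using F_dec by blast
    have yk: "y k \<in> S k" "y k \<in> F" "y k \<in> carrier_mat n n" if "k < m" for k
      using y(1) that S_carrier by blast+
    have "\<forall>k\<in>K. \<exists>d\<in>\<Delta> \<one>. y k = E 0 0 d * s k"
      using s_span yk by (simp add: K_def)
    then obtain d where d: "\<And>k. k \<in> K \<Longrightarrow> d k \<in> \<Delta> \<one>" "\<And>k. k \<in> K \<Longrightarrow> y k = E 0 0 (d k) * s k"
      by metis
    have "r j l = (\<Sum>k\<in>K. d k * s k $$ (0, l))" if l: "l < n" for l
    proof -
      have zero_entry: "y k $$ (0, l) = 0" if "k < m" "k \<notin> K" for k
        using zero_part[OF that yk(1,2)[OF that(1)]] l n_pos by simp
      have "r j l = finsum reg y {..<m} $$ (0, l)"
        using l jn n_pos by (simp add: r_def flip: y(2))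
      also have "\<dots> = (\<Sum>k<m. y k $$ (0, l))"
        using yk l n_pos by (intro finsum_mat_module_index) auto
      also have "\<dots> = (\<Sum>k\<in>K. y k $$ (0, l))"
        using zero_entry by (intro sum.mono_neutral_right) (auto simp: K_def)
      also have "\<dots> = (\<Sum>k\<in>K. d k * s k $$ (0, l))"
        using E_index[OF s(4) n_pos l] d(2) by (intro sum.cong) (auto simp del: index_mult_mat(1))
      finally show ?thesis .
    qed
    then show "\<exists>c. (\<forall>k\<in>K. c k \<in> \<Delta> \<one>) \<and> (\<forall>l\<in>{..<n}. r j l = (\<Sum>k\<in>K. c k * s k $$ (0, l)))"
      using d(1) by (intro exI[of _ d]) auto
  next
    fix x j assume sum0: "\<And>l. l \<in> {..<n} \<Longrightarrow> (\<Sum>j\<in>J. x j * r j l) = 0" and j: "j \<in> J"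
    have "(\<Sum>i\<in>J. x i * r i j) = (\<Sum>i\<in>J. if i = j then x j * u j else 0)"
      by (intro sum.cong) (auto simp: r_def)
    also have "\<dots> = x j * u j" using j finite by simp
    finally have "x j * u j = 0" using sum0[of j] j by (simp add: J_def)
    then have "x j * (u j * u' j) = 0" by (simp flip: mult.assoc)
    then show "x j = 0" using u'(3)[OF j] by simp
  qed (use finite in auto)
  ultimately show ?thesis by (simp add: K_def J_def)
qed

lemma has_multiplicity:
  assumes "gr_simple G A P M"
  shows "has_gr_multiplicity G A P reg M (card {j. j < n \<and> g j \<in> iso_coset M})"
  unfolding has_gr_multiplicity_def
  using col_decomposition decomposition_multiplicity[OF _ assms] by blast

text \<open>An embedding composed with an isomorphism from \<open>V h\<close> sends \<epsilon> to a
  matrix with a nonzero entry in row 0, and the column of that entry gives the index. Conversely, a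
  \<open>g i\<close> in the coset is itself a label of \<open>M\<close>, which then embeds as column
  \<open>i\<close>.\<close>

lemma embeds_iff:
  assumes "gr_simple G A P M"
  shows "gr_embeds G A M reg \<longleftrightarrow> (\<exists>i<n. g i \<in> iso_coset M)"
proof
  have M: "graded_left_module G A P M" using assms by (simp add: gr_simple_def)
  obtain h where h: "h \<in> carrier G" "gr_iso G A (V h) M" using simple_iso_V[OF assms] .
  assume "gr_embeds G A M reg"
  then obtain f where f: "f \<in> gr_hom G A M reg" "inj_on f (carrier M)"
    unfolding gr_embeds_def by blast
  obtain \<phi> where \<phi>: "\<phi> \<in> gr_hom G A (V h) M" "bij_betw \<phi> (carrier (V h)) (carrier M)"
    using h unfolding gr_iso_def by blast
  have hom: "(\<lambda>v. f (\<phi> v)) \<in> gr_hom G A (V h) reg" using gr_hom_compose \<phi>(1) f(1) by blast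
  have "inj_on (\<lambda>v. f (\<phi> v)) (carrier (V h))"
    using comp_inj_on[of \<phi> "carrier (V h)" f] \<phi>(2) f(2) by (simp add: bij_betw_def comp_def)
  then have "f (\<phi> \<epsilon>) \<noteq> 0\<^sub>m n n" using hom_V_\<epsilon>_nonzero[OF h(1) A_graded hom] by simp
  then obtain j where "j < n" "h \<otimes> inv (g j) \<in> H"
    using hom_V_mat_module[OF h(1) _ hom] by auto
  then show "\<exists>i<n. g i \<in> iso_coset M" using coset_membership[OF M h] by blast
next
  have M: "graded_left_module G A P M" using assms by (simp add: gr_simple_def)
  assume "\<exists>i<n. g i \<in> iso_coset M"
  then obtain i where i: "i < n" "gr_iso G A (V (g i)) M" by (auto simp: iso_coset_def)
  then have "gr_iso G A M (V (g i))" using gr_iso_sym[OF V_graded M] by simp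
  then obtain f where f: "f \<in> gr_hom G A M (V (g i))" "bij_betw f (carrier M) (carrier (V (g i)))"
    unfolding gr_iso_def by blast
  note c = col_embedding[OF i(1)]
  have "inj_on (\<lambda>x. f x * unit_mat 1 n 0 i 1) (carrier M)"
    using comp_inj_on[of f "carrier M" "\<lambda>v. v * unit_mat 1 n 0 i 1"] f(2) c(2)
    by (simp add: bij_betw_def comp_def)
  then show "gr_embeds G A M reg"
    unfolding gr_embeds_def using gr_hom_compose[OF f(1) c(1)] by blast
qed

text \<open>The columns of A are graded simple submodules with labels \<open>g i\<close>, which
  gives one direction. For the other, the coset of any graded simple submodule contains some
  \<open>g i\<close> and hence, cosets being disjoint, equals the common coset.\<close>

lemma uniform_iff: "gr_uniform_simple G A P \<longleftrightarrow> (\<exists>C\<in>rcosets H. \<forall>i<n. g i \<in> C)"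
proof
  assume uniform: "gr_uniform_simple G A P"
  let ?C = "iso_coset (gr_restrict reg (col_module 0))"
  have "g i \<in> ?C" if i: "i < n" for i
  proof -
    have "gr_iso G A (gr_restrict reg (col_module i)) (gr_restrict reg (col_module 0))"
      using uniform col_module[OF i] col_module[OF n_pos]
      unfolding gr_uniform_simple_def Let_def regular_eq by blast
    then show ?thesis using gr_iso_trans[OF col_module(2)[OF i]] i by (simp add: iso_coset_def)
  qed
  then show "\<exists>C\<in>rcosets H. \<forall>i<n. g i \<in> C" using iso_coset_simple(1)[OF col_module(3)[OF n_pos]] by blast
next
  assume "\<exists>C\<in>rcosets H. \<forall>i<n. g i \<in> C"
  then obtain C where C: "C \<in> rcosets H" "\<And>i. i < n \<Longrightarrow> g i \<in> C" by blast
  interpret reg: graded_left_module G A P reg by (rule A_graded)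
  have "iso_coset (gr_restrict reg N) = C"
    if N: "gr_submodule G A reg N" "gr_simple G A P (gr_restrict reg N)" for N
  proof -
    have "gr_embeds G A (gr_restrict reg N) reg"
      unfolding gr_embeds_def using gr_hom_inclusion[OF reg.gr_submoduleD(1)[OF N(1)]]
      by (intro bexI[of _ "\<lambda>x. x"]) auto
    then obtain i where "i < n" "g i \<in> iso_coset (gr_restrict reg N)" using embeds_iff[OF N(2)] by blast
    then show ?thesis
      using rcos_disjoint[OF subgroup_supp] iso_coset_simple(1)[OF N(2)] C
      unfolding pairwise_def disjnt_def by blast
  qed
  then show "gr_uniform_simple G A P"
    unfolding gr_uniform_simple_def Let_def regular_eq using gr_iso_iff_iso_coset by metis
qed

section \<open>Isomorphism types and their cosets\<close>

lemma gr_simple_types_iff: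
  fixes T :: "('d mat, 'e, 'a) gr_module set"
  shows "T \<in> gr_simple_types G A P \<longleftrightarrow>
    (\<exists>M :: ('d mat, 'e, 'a) gr_module. gr_simple G A P M \<and> T = {N. gr_simple G A P N \<and> gr_iso G A M N})"
  unfolding gr_simple_types_def quotient_def by auto

lemma type_of_simple:
  fixes M :: "('d mat, 'e, 'a) gr_module"
  assumes "T \<in> gr_simple_types G A P" "M \<in> T"
  shows "gr_simple G A P M" "T = {N. gr_simple G A P N \<and> iso_coset N = iso_coset M}"
proof -
  obtain M0 :: "('d mat, 'e, 'a) gr_module"
    where M0: "gr_simple G A P M0" "T = {N. gr_simple G A P N \<and> gr_iso G A M0 N}"
    using assms(1) unfolding gr_simple_types_iff by blast
  then have T: "T = {N. gr_simple G A P N \<and> iso_coset N = iso_coset M0}"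
    using gr_iso_iff_iso_coset[OF M0(1)] by auto
  then show "gr_simple G A P M" "T = {N. gr_simple G A P N \<and> iso_coset N = iso_coset M}"
    using assms(2) by auto
qed

lemma type_nonempty:
  fixes T :: "('d mat, 'e, 'a) gr_module set"
  assumes "T \<in> gr_simple_types G A P"
  obtains M where "M \<in> T"
proof -
  obtain M :: "('d mat, 'e, 'a) gr_module"
    where "gr_simple G A P M" "T = {N. gr_simple G A P N \<and> gr_iso G A M N}"
    using assms unfolding gr_simple_types_iff by blast
  then show ?thesis using that[of M] gr_iso_refl by auto
qed

text \<open>The choice of a representative is harmless, because \<open>iso_coset\<close> is constant
  on a type.\<close>

definition type_coset :: "('d mat, 'e, 'a) gr_module set \<Rightarrow> 'a set" where
  "type_coset T = iso_coset (SOME M. M \<in> T)"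

lemma type_coset_eq:
  assumes "T \<in> gr_simple_types G A P" "M \<in> T"
  shows "type_coset T = iso_coset M"
proof -
  have "(SOME M. M \<in> T) \<in> T" using assms(2) by (rule someI)
  then show ?thesis using type_of_simple(2)[OF assms] by (auto simp: type_coset_def)
qed

text \<open>Injective because the coset determines the isomorphism class; onto because \<iota>
  leaves room in \<open>'m\<close> for a copy of every column module.\<close>

lemma type_coset_bij:
  fixes \<iota> :: "'d mat \<Rightarrow> 'm"
  assumes "inj_on \<iota> (carrier_mat n n)"
  shows "bij_betw type_coset (gr_simple_types G A P :: ('d mat, 'm, 'a) gr_module set set) (rcosets H)"
  unfolding bij_betw_def
proof
  show "inj_on type_coset (gr_simple_types G A P :: ('d mat, 'm, 'a) gr_module set set)"
  proof (rule inj_onI)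
    fix T T' :: "('d mat, 'm, 'a) gr_module set"
    assume T: "T \<in> gr_simple_types G A P" "T' \<in> gr_simple_types G A P" "type_coset T = type_coset T'"
    obtain M M' where M: "M \<in> T" "M' \<in> T'" using type_nonempty T by metis
    show "T = T'"
      using type_of_simple(2)[OF T(1) M(1)] type_of_simple(2)[OF T(2) M(2)]
        type_coset_eq[OF T(1) M(1)] type_coset_eq[OF T(2) M(2)] T(3) by simp
  qed
  show "type_coset ` (gr_simple_types G A P :: ('d mat, 'm, 'a) gr_module set set) = rcosets H"
  proof
    show "type_coset ` (gr_simple_types G A P :: ('d mat, 'm, 'a) gr_module set set) \<subseteq> rcosets H"
    proof safe
      fix T :: "('d mat, 'm, 'a) gr_module set"
      assume T: "T \<in> gr_simple_types G A P"
      then obtain M where M: "M \<in> T" using type_nonempty by blast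
      then show "type_coset T \<in> rcosets H"
        using type_coset_eq[OF T M] iso_coset_simple(1)[OF type_of_simple(1)[OF T M]] by simp
    qed
    show "rcosets H \<subseteq> type_coset ` (gr_simple_types G A P :: ('d mat, 'm, 'a) gr_module set set)"
    proof
      fix C assume "C \<in> rcosets H"
      then obtain M :: "('d mat, 'm, 'a) gr_module" where M: "gr_simple G A P M" "iso_coset M = C"
        using ex_simple_with_coset[OF assms] by blast
      let ?T = "{N :: ('d mat, 'm, 'a) gr_module. gr_simple G A P N \<and> gr_iso G A M N}"
      have T: "?T \<in> gr_simple_types G A P"
        unfolding gr_simple_types_iff using M(1) by blast
      have "M \<in> ?T" using M(1) gr_iso_refl by auto
      then have "type_coset ?T = C" using type_coset_eq[OF T] M(2) by simp
      then show "C \<in> type_coset ` (gr_simple_types G A P :: ('d mat, 'm, 'a) gr_module set set)"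
        using T by blast
    qed
  qed
qed

end

text \<open>The index is expressed by equipollence with the set of right cosets, so infinite indices
  are compared as cardinals. One map, \<open>type_coset\<close>, serves both (i) and (ii).\<close>

theorem corollary2p3:
  fixes G :: "('g, 'x) monoid_scheme"
    and \<Delta> :: "'g \<Rightarrow> 'd::ring_1 set"
    and n :: nat
    and g :: "nat \<Rightarrow> 'g"
    and \<iota> :: "'d mat \<Rightarrow> 'm"
  assumes "group G"
    and "graded_division_ring G (class_ring :: 'd ring) \<Delta>"
    and "n > 0"
    and "\<forall>i<n. g i \<in> carrier G"
    and "inj_on \<iota> (carrier_mat n n)"
  shows
    "let H = gr_supp G (class_ring :: 'd ring) \<Delta>;
         A = ring_mat TYPE('d) n ();
         P = matrix_grading G \<Delta> n g;
         types = (gr_simple_types G A P :: ('d mat, 'm, 'g) gr_module set set);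
         embedded_types = {T \<in> types. \<exists>M\<in>T. gr_embeds G A M (regular_gr_module A P)}
     in
       types \<approx> rcosets\<^bsub>G\<^esub> H \<and>
       (\<exists>\<Phi>. bij_betw \<Phi> embedded_types {C \<in> rcosets\<^bsub>G\<^esub> H. \<exists>i<n. g i \<in> C} \<and>
            (\<forall>T\<in>embedded_types. \<forall>M\<in>T.
               has_gr_multiplicity G A P (regular_gr_module A P) M
                 (card {i. i < n \<and> g i \<in> \<Phi> T}))) \<and>
       (gr_uniform_simple G A P \<longleftrightarrow> (\<exists>C\<in>rcosets\<^bsub>G\<^esub> H. \<forall>i<n. g i \<in> C))"
proof -
  interpret graded_matrix_ring G \<Delta> n g
    using assms(1-4)
    by (simp add: graded_matrix_ring_def graded_matrix_ring_axioms_def graded_division_def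
        graded_division_axioms_def)
  let ?types = "gr_simple_types G A P :: ('d mat, 'm, 'g) gr_module set set"
  let ?emb = "{T \<in> ?types. \<exists>M\<in>T. gr_embeds G A M reg}"
  note bij = type_coset_bij[OF assms(5)]
  \<comment> \<open>All members of a type share one coset, so some member embeds into A exactly when
    every member does.\<close>
  have emb: "(\<exists>M\<in>T. gr_embeds G A M reg) \<longleftrightarrow> (\<exists>i<n. g i \<in> type_coset T)" if T: "T \<in> ?types" for T
  proof -
    have "gr_embeds G A M reg \<longleftrightarrow> (\<exists>i<n. g i \<in> type_coset T)" if "M \<in> T" for M
      using embeds_iff[OF type_of_simple(1)[OF T that]] type_coset_eq[OF T that] by simp
    moreover obtain M where "M \<in> T" using type_nonempty[OF T] .
    ultimately show ?thesis by auto
  qed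
  have "type_coset ` ?emb = {C \<in> rcosets\<^bsub>G\<^esub> H. \<exists>i<n. g i \<in> C}"
  proof -
    have "?emb = {T \<in> ?types. \<exists>i<n. g i \<in> type_coset T}" using emb by blast
    moreover have "rcosets\<^bsub>G\<^esub> H = type_coset ` ?types" using bij by (simp add: bij_betw_def)
    ultimately show ?thesis by auto
  qed
  then have "bij_betw type_coset ?emb {C \<in> rcosets\<^bsub>G\<^esub> H. \<exists>i<n. g i \<in> C}"
    using bij by (intro bij_betw_subset[OF bij]) auto
  moreover have "has_gr_multiplicity G A P reg M (card {i. i < n \<and> g i \<in> type_coset T})"
    if "T \<in> ?emb" "M \<in> T" for T M
  proof -
    have T: "T \<in> ?types" using that by simp
    show ?thesis
      using has_multiplicity[OF type_of_simple(1)[OF T that(2)]] type_coset_eq[OF T that(2)] by simp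
  qed
  moreover have "?types \<approx> rcosets\<^bsub>G\<^esub> H" using bij by (auto simp: eqpoll_def)
  ultimately show ?thesis
    unfolding Let_def regular_eq by (intro conjI exI[of _ type_coset] ballI uniform_iff)
qed

end
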